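(* Let $G\subseteq K_{m,n}$ be a bipartite graph with no isolated vertices, and let $y_1,\dots,y_m$ be nonnegative real numbers. The volume of the generalized permutohedron $P_G(y_1,\dots,y_m)$ equals $$\mathrm{Vol}\,P_G(y_1,\dots,y_m)=\sum_{(a_1,\dots,a_m)}\frac{y_1^{a_1}}{a_1!}\cdots\frac{y_m^{a_m}}{a_m!},$$ where the sum is over all $G$-draconian sequences $(a_1,\dots,a_m)$.
   Context: $[n]=\{1,\dots,n\}$; $m,n\ge1$. The vertices of $G\subseteq K_{m,n}$ are labeled $1,\dots,m$ (left vertices) and $\bar1,\dots,\bar n$ (right vertices). $G$ is associated with the nonempty subsets $I_1,\dots,I_m\subseteq[n]$ given by $j\in I_i$ if and only if $(i,\bar j)$ is an edge of $G$. For nonempty $I\subseteq[n]$, $\Delta_I=\mathrm{ConvexHull}(e_i\mid i\in I)\subset\mathbb{R}^n$, with $e_i$ the coordinate vectors. The generalized permutohedron is the Minkowski sum $P_G(y_1,\dots,y_m)=y_1\Delta_{I_1}+\cdots+y_m\Delta_{I_m}$; it lies in the hyperplane $t_1+\cdots+t_n=y_1+\cdots+y_m$. $\mathrm{Vol}$ denotes the usual $(n-1)$-dimensional volume of the image under the projection $(t_1,\dots,t_n)\mapsto(t_1,\dots,t_{n-1})$ (for $n=1$ the volume of a point is $1$). Convention: $z^0=1$ for all $z$. A sequence of nonnegative integers $(a_1,\dots,a_m)$ is $G$-draconian if $\sum_i a_i=n-1$ and, for any nonempty subset $\{i_1<\cdots<i_k\}\subseteq[m]$, we have $|I_{i_1}\cup\cdots\cup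 I_{i_k}|\ge a_{i_1}+\cdots+a_{i_k}+1$. *)

theory Defs
  imports "HOL-Analysis.Analysis" "HOL-Library.Function_Algebras"
begin

text \<open>
  \<open>\<real>\<^sup>n\<close> is represented by the functions of type \<open>nat \<Rightarrow> real\<close> that vanish outside
  \<open>{1..n}\<close>, so that \<open>n\<close> is an ordinary natural number.  The instance below makes the
  library's \<open>convex hull\<close> and \<open>scaleR\<close> available for them.
\<close>

instantiation "fun" :: (type, real_vector) real_vector
begin

definition scaleR_fun :: "real \<Rightarrow> ('a \<Rightarrow> 'b) \<Rightarrow> 'a \<Rightarrow> 'b" where
  "scaleR_fun c f = (\<lambda>x. c *\<^sub>R f x)"

instance
  by standard (simp_all add: scaleR_fun_def fun_eq_iff scaleR_add_right scaleR_add_left)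

end

text \<open>
  A bipartite graph \<open>G \<subseteq> K\<^sub>m\<^sub>,\<^sub>n\<close> is given by its set of edges: \<open>(i, j) \<in> G\<close> is the edge
  between the left vertex \<open>i \<in> {1..m}\<close> and the right vertex \<open>j \<in> {1..n}\<close>.
\<close>

definition bipartite_subgraph :: "nat \<Rightarrow> nat \<Rightarrow> (nat \<times> nat) set \<Rightarrow> bool" where
  "bipartite_subgraph m n G \<longleftrightarrow> G \<subseteq> {1..m} \<times> {1..n}"

definition no_isolated_vertices :: "nat \<Rightarrow> nat \<Rightarrow> (nat \<times> nat) set \<Rightarrow> bool" where
  "no_isolated_vertices m n G \<longleftrightarrow>
     (\<forall>i\<in>{1..m}. \<exists>j\<in>{1..n}. (i, j) \<in> G) \<and> (\<forall>j\<in>{1..n}. \<exists>i\<in>{1..m}. (i, j) \<in> G)"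

definition nbrs :: "(nat \<times> nat) set \<Rightarrow> nat \<Rightarrow> nat set" where
  "nbrs G i = {j. (i, j) \<in> G}"

definition coord_vec :: "nat \<Rightarrow> nat \<Rightarrow> real" where
  "coord_vec i = (\<lambda>j. if j = i then 1 else 0)"

definition coord_simplex :: "nat set \<Rightarrow> (nat \<Rightarrow> real) set" where
  "coord_simplex I = convex hull (coord_vec ` I)"

text \<open>The sum below is one of sets, i.e. a Minkowski sum.\<close>

definition gen_permutohedron ::
    "nat \<Rightarrow> (nat \<times> nat) set \<Rightarrow> (nat \<Rightarrow> real) \<Rightarrow> (nat \<Rightarrow> real) set" where
  "gen_permutohedron m G y = (\<Sum>i\<in>{1..m}. (\<lambda>t. y i *\<^sub>R t) ` coord_simplex (nbrs G i))"

text \<open>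
  Lebesgue measure of the projection to the coordinates \<open>1, \<dots>, n - 1\<close>.  For \<open>n = 1\<close> the
  product measure is the unit mass on the one-point space, so that a point has volume 1.
\<close>

definition proj_vol :: "nat \<Rightarrow> (nat \<Rightarrow> real) set \<Rightarrow> real" where
  "proj_vol n P = measure (Pi\<^sub>M {1..<n} (\<lambda>_. lborel)) ((\<lambda>t. restrict t {1..<n}) ` P)"

text \<open>
  Sequences \<open>(a\<^sub>1, \<dots>, a\<^sub>m)\<close> are extensional functions on \<open>{1..m}\<close>, so that distinct
  functions are distinct sequences.
\<close>

definition draconian :: "nat \<Rightarrow> nat \<Rightarrow> (nat \<times> nat) set \<Rightarrow> (nat \<Rightarrow> nat) \<Rightarrow> bool" where
  "draconian m n G a \<longleftrightarrow>
     a \<in> {1..m} \<rightarrow>\<^sub>E UNIV \<and>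
     (\<Sum>i\<in>{1..m}. a i) = n - 1 \<and>
     (\<forall>J. J \<subseteq> {1..m} \<and> J \<noteq> {} \<longrightarrow> card (\<Union>i\<in>J. nbrs G i) \<ge> (\<Sum>i\<in>J. a i) + 1)"

lemma finite_draconian: "finite {a. draconian m n G a}"
proof (rule finite_subset)
  show "{a. draconian m n G a} \<subseteq> {1..m} \<rightarrow>\<^sub>E {..n - 1}"
  proof (clarify)
    fix a assume a: "draconian m n G a"
    have "a i \<le> n - 1" if "i \<in> {1..m}" for i
      using a member_le_sum[of i "{1..m}" a] that by (simp add: draconian_def)
    then show "a \<in> {1..m} \<rightarrow>\<^sub>E {..n - 1}"
      using a by (auto simp: draconian_def PiE_iff)
  qed
qed (simp add: finite_PiE)

end

theory Submission
  imports Defs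
begin

text \<open>
  By max-flow/min-cut, \<open>P\<^sub>G(y)\<close> is the base polytope of all \<open>t\<close> with \<open>t([n]) = \<Sum> y\<close> and
  \<open>t(S) \<le> h(S)\<close> for \<open>S \<subseteq> [n]\<close>, where \<open>h(S)\<close> is the sum of the \<open>y\<^sub>i\<close> with \<open>I\<^sub>i \<inter> S \<noteq> {}\<close>.
  Fix \<open>j \<in> I\<^sub>m\<close> and let \<open>y\<^sub>m\<close> grow from \<open>0\<close>.  After translation by \<open>- y\<^sub>m e\<^sub>j\<close> only the
  constraints of sets \<open>S\<close> with \<open>j \<notin> S\<close> and \<open>S \<inter> I\<^sub>m \<noteq> {}\<close> move, each at unit speed, so the region
  gained is swept out by the corresponding faces.  Such a face is a product of two base polytopes,
  on the ground sets \<open>S\<close> and \<open>[n] - S\<close>, whose volumes are known by induction.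

  The draconian sum obeys the same recursion:  if \<open>a\<close> is draconian with \<open>a\<^sub>m > 0\<close>, then
  \<open>a - e\<^sub>m\<close> splits into draconian sequences on \<open>S\<close> and \<open>[n] - S\<close> for exactly one such \<open>S\<close>.
\<close>

section \<open>Draconian sequences and their splittings\<close>

text \<open>Draconian sequences are restated by subsets \<open>W\<close> of the ground set instead
  of subsets of indices. The condition then consists of strict upper bounds on a supermodular
  function of \<open>W\<close>, and it passes to \<open>S\<close> and to \<open>E - S\<close>, so
  the induction can range over arbitrary set systems. The equality cases of these bounds form a
  family closed under union as long as they share a common point, and \<open>j\<close> is that
  point; the complement of the largest such set is the unique \<open>S\<close>. On the volume side,
  a point joins the growing region when the last moving constraint becomes satisfied. Ties between
  two constraints have measure zero, so almost every new point belongs to exactly one face. Jacobian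
  factors never arise, because all volumes are taken after dropping one coordinate: exchanging the
  dropped coordinate is a reflection, and slicing by a coordinate sum is a shear. Both sides thus
  satisfy the same integral equation in \<open>y m\<close>. Its initial value has one summand fewer,
  and its integrand only involves smaller ground sets.\<close>

definition drac :: "'b set \<Rightarrow> 'a set \<Rightarrow> ('a \<Rightarrow> 'b set) \<Rightarrow> ('a \<Rightarrow> nat) \<Rightarrow> bool" where
  "drac E M I a \<longleftrightarrow> sum a M + 1 = card E \<and>
     (\<forall>W\<subseteq>E. W \<noteq> {} \<longrightarrow> (\<Sum>i | i \<in> M \<and> I i \<subseteq> W. a i) < card W)"

definition drac_seqs :: "'b set \<Rightarrow> 'a set \<Rightarrow> ('a \<Rightarrow> 'b set) \<Rightarrow> ('a \<Rightarrow> nat) set" where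
  "drac_seqs E M I = {a \<in> M \<rightarrow>\<^sub>E UNIV. drac E M I a}"

definition monom_val :: "'a set \<Rightarrow> ('a \<Rightarrow> real) \<Rightarrow> ('a \<Rightarrow> nat) \<Rightarrow> real" where
  "monom_val M y a = (\<Prod>i\<in>M. y i ^ a i / fact (a i))"

definition drac_sum :: "'b set \<Rightarrow> 'a set \<Rightarrow> ('a \<Rightarrow> 'b set) \<Rightarrow> ('a \<Rightarrow> real) \<Rightarrow> real" where
  "drac_sum E M I y = (\<Sum>a\<in>drac_seqs E M I. monom_val M y a)"

text \<open>On the face of \<open>S\<close>, these indices live on \<open>S\<close> with the traces
  \<open>I i \<inter> S\<close>, while those of \<open>avoiding\<close> keep their sets, which lie
  in the complement.\<close>

definition meeting :: "'a set \<Rightarrow> ('a \<Rightarrow> 'b set) \<Rightarrow> 'b set \<Rightarrow> 'a set" where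
  "meeting M I S = {i \<in> M. I i \<inter> S \<noteq> {}}"

definition avoiding :: "'a set \<Rightarrow> ('a \<Rightarrow> 'b set) \<Rightarrow> 'b set \<Rightarrow> 'a set" where
  "avoiding M I S = {i \<in> M. I i \<inter> S = {}}"

lemma meeting_avoiding:
  "meeting M I S \<union> avoiding M I S = M" "meeting M I S \<inter> avoiding M I S = {}"
  by (auto simp: meeting_def avoiding_def)

lemma finite_meeting [simp]: "finite M \<Longrightarrow> finite (meeting M I S)"
  and finite_avoiding [simp]: "finite M \<Longrightarrow> finite (avoiding M I S)"
  by (auto simp: meeting_def avoiding_def)

lemma finite_drac_seqs:
  assumes "finite M"
  shows "finite (drac_seqs E M I)"
proof (rule finite_subset)
  show "drac_seqs E M I \<subseteq> M \<rightarrow>\<^sub>E {..card E}"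
  proof
    fix a assume a: "a \<in> drac_seqs E M I"
    have "a i \<le> card E" if "i \<in> M" for i
      using a member_le_sum[of i M a] that assms by (simp add: drac_seqs_def drac_def)
    then show "a \<in> M \<rightarrow>\<^sub>E {..card E}"
      using a by (auto simp: drac_seqs_def PiE_iff)
  qed
qed (simp add: assms finite_PiE)

lemma drac_cong:
  assumes "\<And>i. i \<in> M \<Longrightarrow> a i = b i"
  shows "drac E M I a \<longleftrightarrow> drac E M I b"
proof -
  have "(\<Sum>i | i \<in> M \<and> I i \<subseteq> W. a i) = (\<Sum>i | i \<in> M \<and> I i \<subseteq> W. b i)" for W
    by (rule sum.cong) (use assms in auto)
  moreover have "sum a M = sum b M"
    by (rule sum.cong) (use assms in auto)
  ultimately show ?thesis
    by (simp add: drac_def)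
qed

text \<open>A set inside \<open>U\<close> or \<open>V\<close> lies in the union, and one inside both
  lies in the intersection. As cardinality is modular, equality in the draconian bounds will be
  inherited by unions.\<close>

lemma supermodular_subset_sum:
  fixes a :: "'a \<Rightarrow> nat"
  assumes "finite M"
  shows "(\<Sum>i | i \<in> M \<and> I i \<subseteq> U. a i) + (\<Sum>i | i \<in> M \<and> I i \<subseteq> V. a i)
    \<le> (\<Sum>i | i \<in> M \<and> I i \<subseteq> U \<union> V. a i) + (\<Sum>i | i \<in> M \<and> I i \<subseteq> U \<inter> V. a i)"
proof -
  let ?A = "{i. i \<in> M \<and> I i \<subseteq> U}" and ?B = "{i. i \<in> M \<and> I i \<subseteq> V}"
  have "sum a ?A + sum a ?B = sum a (?A \<union> ?B) + sum a (?A \<inter> ?B)"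
    using assms by (simp add: sum.union_inter)
  also have "?A \<inter> ?B = {i. i \<in> M \<and> I i \<subseteq> U \<inter> V}" by auto
  also have "sum a (?A \<union> ?B) \<le> (\<Sum>i | i \<in> M \<and> I i \<subseteq> U \<union> V. a i)"
    by (rule sum_mono2) (use assms in auto)
  finally show ?thesis by simp
qed

section \<open>The cut belonging to a sequence, found through tight sets\<close>

locale drac_step =
  fixes E :: "'b set" and M :: "'a set" and I :: "'a \<Rightarrow> 'b set" and m :: 'a and j :: 'b
  assumes finE: "finite E" and finM: "finite M" and mM: "m \<in> M"
    and sub: "\<And>i. i \<in> M \<Longrightarrow> I i \<subseteq> E" and ne: "\<And>i. i \<in> M \<Longrightarrow> I i \<noteq> {}"
    and jm: "j \<in> I m"
begin

definition cuts :: "'b set set" where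
  "cuts = {S. S \<subseteq> E \<and> j \<notin> S \<and> S \<inter> I m \<noteq> {}}"

text \<open>Differentiating in \<open>y m\<close> lowers the exponent at \<open>m\<close> by one, so
  the exponents after differentiation are the \<open>a\<close> for which \<open>raise a\<close> is
  draconian.\<close>

definition raise :: "('a \<Rightarrow> nat) \<Rightarrow> 'a \<Rightarrow> nat" where
  "raise a = a(m := Suc (a m))"

definition splits :: "'b set \<Rightarrow> ('a \<Rightarrow> nat) \<Rightarrow> bool" where
  "splits S a \<longleftrightarrow> drac S (meeting M I S) (\<lambda>i. I i \<inter> S) a \<and> drac (E - S) (avoiding M I S) I a"

abbreviation F :: "('a \<Rightarrow> nat) \<Rightarrow> 'b set \<Rightarrow> nat" where
  "F a U \<equiv> (\<Sum>i | i \<in> M \<and> I i \<subseteq> U. a i)"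

text \<open>The largest value that \<open>F a U\<close> can take when \<open>raise a\<close> is
  draconian. Demanding \<open>j \<in> U\<close> makes any two tight sets intersect.\<close>

definition tight :: "('a \<Rightarrow> nat) \<Rightarrow> 'b set \<Rightarrow> bool" where
  "tight a U \<longleftrightarrow> j \<in> U \<and> U \<subseteq> E \<and> F a U + 1 = card U"

lemma jE: "j \<in> E"
  using sub[OF mM] jm by blast

lemma finite_cuts: "finite cuts"
  by (rule finite_subset[of _ "Pow E"]) (auto simp: cuts_def finE)

lemma sum_raise:
  assumes "finite A"
  shows "sum (raise a) A = sum a A + (if m \<in> A then 1 else 0)"
proof (cases "m \<in> A")
  case True
  then have "sum (raise a) A = raise a m + sum (raise a) (A - {m})" "sum a A = a m + sum a (A - {m})"
    using assms by (simp_all add: sum.remove)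
  moreover have "sum (raise a) (A - {m}) = sum a (A - {m})"
    by (rule sum.cong) (auto simp: raise_def)
  ultimately show ?thesis using True by (simp add: raise_def)
next
  case False
  then have "sum (raise a) A = sum a A"
    by (intro sum.cong) (auto simp: raise_def)
  then show ?thesis using False by simp
qed

lemma F_raise: "F (raise a) U = F a U + (if I m \<subseteq> U then 1 else 0)"
  using sum_raise[of "{i. i \<in> M \<and> I i \<subseteq> U}" a] finM mM by simp

text \<open>The raised index uses up one unit wherever \<open>I m \<subseteq> U\<close>, which
  leaves one more unit to spare for \<open>a\<close>. Hence a tight set never contains
  \<open>I m\<close>.\<close>

lemma F_less:
  assumes "drac E M I (raise a)" "U \<subseteq> E" "U \<noteq> {}"
  shows "F a U < card U" and "I m \<subseteq> U \<Longrightarrow> F a U + 1 < card U"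
proof -
  have "F (raise a) U < card U" using assms by (auto simp: drac_def)
  then show "F a U < card U" and "I m \<subseteq> U \<Longrightarrow> F a U + 1 < card U"
    by (auto simp: F_raise)
qed

lemma sum_total: "drac E M I (raise a) \<Longrightarrow> sum a M + 2 = card E"
  using sum_raise[OF finM, of a] mM by (simp add: drac_def)

text \<open>Union and intersection are nonempty because of \<open>j\<close>, so each obeys the
  strict bound. Supermodularity and the additivity of cardinalities leave no room for slack in
  either.\<close>

lemma tight_Un:
  assumes "drac E M I (raise a)" "tight a U" "tight a V"
  shows "tight a (U \<union> V)"
proof -
  have fin: "finite U" "finite V"
    using assms finE by (auto simp: tight_def intro: finite_subset)
  have "F a U + F a V \<le> F a (U \<union> V) + F a (U \<inter> V)"
    by (rule supermodular_subset_sum[OF finM])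
  moreover have "F a (U \<inter> V) < card (U \<inter> V)" "F a (U \<union> V) < card (U \<union> V)"
    using assms by (intro F_less(1); force simp: tight_def)+
  moreover have "card U + card V = card (U \<union> V) + card (U \<inter> V)"
    using fin by (rule card_Un_Int)
  ultimately show ?thesis
    using assms(2,3) unfolding tight_def by auto
qed

text \<open>A set inside \<open>(E - S) \<union> W\<close> either avoids \<open>S\<close> or meets
  \<open>S\<close> with trace in \<open>W\<close>. This expresses the conditions on \<open>S\<close>
  as increments of \<open>F\<close> above \<open>E - S\<close>.\<close>

lemma F_diff_meeting:
  assumes "S \<subseteq> E"
  shows "avoiding M I S = {i. i \<in> M \<and> I i \<subseteq> E - S}"
    and "W \<subseteq> S \<Longrightarrow> (\<Sum>i | i \<in> meeting M I S \<and> I i \<inter> S \<subseteq> W. a i) + F a (E - S) = F a ((E - S) \<union> W)"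
    and "W \<subseteq> E - S \<Longrightarrow> (\<Sum>i | i \<in> avoiding M I S \<and> I i \<subseteq> W. a i) = F a W"
proof -
  show *: "avoiding M I S = {i. i \<in> M \<and> I i \<subseteq> E - S}"
    using sub by (auto simp: avoiding_def)
  show "(\<Sum>i | i \<in> meeting M I S \<and> I i \<inter> S \<subseteq> W. a i) + F a (E - S) = F a ((E - S) \<union> W)" if "W \<subseteq> S"
  proof -
    have "{i. i \<in> M \<and> I i \<subseteq> (E - S) \<union> W} =
      {i. i \<in> meeting M I S \<and> I i \<inter> S \<subseteq> W} \<union> {i. i \<in> M \<and> I i \<subseteq> E - S}"
      using sub by (auto simp: meeting_def)
    moreover have "{i. i \<in> meeting M I S \<and> I i \<inter> S \<subseteq> W} \<inter> {i. i \<in> M \<and> I i \<subseteq> E - S} = {}"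
      by (auto simp: meeting_def)
    ultimately show ?thesis
      using finM by (simp add: sum.union_disjoint)
  qed
  show "(\<Sum>i | i \<in> avoiding M I S \<and> I i \<subseteq> W. a i) = F a W" if "W \<subseteq> E - S"
    by (rule sum.cong) (use that * in auto)
qed

lemma splits_tight:
  assumes "S \<in> cuts" "splits S a"
  shows "tight a (E - S)"
  using assms jE F_diff_meeting(1)[of S] by (auto simp: splits_def tight_def cuts_def drac_def)

text \<open>Tightness of the enlarged set would push the trace sum of \<open>W\<close> up to
  \<open>card W\<close>, against the draconian bound on \<open>S\<close>. So \<open>E - S\<close> is
  a maximal tight set.\<close>

lemma splits_maximal:
  assumes "S \<in> cuts" "splits S a" "W \<subseteq> S" "W \<noteq> {}"
  shows "\<not> tight a ((E - S) \<union> W)"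
proof
  assume t: "tight a ((E - S) \<union> W)"
  have fin: "finite S" "finite W" "S \<subseteq> E"
    using assms finE by (auto simp: cuts_def dest: finite_subset intro: rev_finite_subset)
  have "card ((E - S) \<union> W) = card (E - S) + card W"
    using fin finE assms(3) by (intro card_Un_disjoint) auto
  moreover have "(\<Sum>i | i \<in> meeting M I S \<and> I i \<inter> S \<subseteq> W. a i) < card W"
    using assms by (auto simp: splits_def drac_def)
  moreover have "F a (E - S) + 1 = card (E - S)"
    using splits_tight[OF assms(1,2)] by (simp add: tight_def)
  ultimately show False
    using t F_diff_meeting(2)[OF fin(3) assms(3), of a] unfolding tight_def by linarith
qed

lemma splits_imp_drac:
  assumes S: "S \<in> cuts" and a: "splits S a"
  shows "drac E M I (raise a)"
proof -
  have SE: "S \<subseteq> E" "j \<notin> S" "S \<inter> I m \<noteq> {}" "finite S"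
    using S finE by (auto simp: cuts_def intro: finite_subset)
  have dA: "sum a (meeting M I S) + 1 = card S"
    "\<And>W. W \<subseteq> S \<Longrightarrow> W \<noteq> {} \<Longrightarrow> (\<Sum>i | i \<in> meeting M I S \<and> I i \<inter> S \<subseteq> W. a i) < card W"
    and dB: "sum a (avoiding M I S) + 1 = card (E - S)"
    "\<And>W. W \<subseteq> E - S \<Longrightarrow> W \<noteq> {} \<Longrightarrow> F a W < card W"
    using a F_diff_meeting(3)[OF SE(1), of _ a] by (auto simp: splits_def drac_def)
  have "sum a M = sum a (meeting M I S) + sum a (avoiding M I S)"
    using sum.union_disjoint[of "meeting M I S" "avoiding M I S" a] finM
    by (simp add: meeting_avoiding)
  moreover have "card E = card S + card (E - S)"
    using card_Un_disjoint[of S "E - S"] SE finE by (simp add: Un_absorb1)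
  ultimately have total: "sum (raise a) M + 1 = card E"
    using sum_raise[OF finM, of a] dA(1) dB(1) mM by simp
  have "F (raise a) W < card W" if W: "W \<subseteq> E" "W \<noteq> {}" for W
  proof -
    let ?A = "{i. i \<in> meeting M I S \<and> I i \<inter> S \<subseteq> W \<inter> S}"
    have "{i. i \<in> M \<and> I i \<subseteq> W} \<subseteq> ?A \<union> {i. i \<in> M \<and> I i \<subseteq> W - S}"
      by (auto simp: meeting_def)
    then have "F a W \<le> sum a (?A \<union> {i. i \<in> M \<and> I i \<subseteq> W - S})"
      using finM by (intro sum_mono2) auto
    also have "\<dots> \<le> sum a ?A + F a (W - S)"
      using finM by (simp add: sum_Un_nat)
    finally have le: "F a W \<le> sum a ?A + F a (W - S)" .
    have cW: "card W = card (W \<inter> S) + card (W - S)"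
      using finite_subset[OF W(1) finE] by (metis card_Int_Diff)
    \<comment> \<open>If \<open>W\<close> has points on both sides, two strict bounds leave the unit
      that the raised index may cost. If \<open>W\<close> lies on one side there is only one strict
      bound, but then \<open>I m\<close> is not inside \<open>W\<close>: it meets \<open>S\<close>,
      and it contains \<open>j\<close>, which is outside \<open>S\<close>.\<close>
    consider "W \<inter> S = {}" | "W - S = {}" | "W \<inter> S \<noteq> {}" "W - S \<noteq> {}" by blast
    then show ?thesis
    proof cases
      case 1
      then have e: "?A = {}" by (auto simp: meeting_def)
      have "F a (W - S) < card (W - S)"
        using 1 W by (intro dB(2)) auto
      moreover have "\<not> I m \<subseteq> W" using 1 SE by blast
      ultimately show ?thesis using le cW unfolding e by (simp add: F_raise)
    next
      case 2
      then have e: "{i. i \<in> M \<and> I i \<subseteq> W - S} = {}" using ne by auto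
      moreover have "sum a ?A < card (W \<inter> S)"
        using 2 W by (intro dA(2)) auto
      moreover have "\<not> I m \<subseteq> W" using 2 SE jm by blast
      ultimately show ?thesis using le cW unfolding e by (simp add: F_raise)
    next
      case 3
      have "sum a ?A < card (W \<inter> S)" using 3 by (intro dA(2)) auto
      moreover have "F a (W - S) < card (W - S)" using 3 W by (intro dB(2)) auto
      ultimately show ?thesis using le cW by (simp add: F_raise)
    qed
  qed
  with total show ?thesis by (simp add: drac_def)
qed

text \<open>The complements of both cuts are tight, hence so is their union; by maximality it adds
  nothing to either complement.\<close>

lemma splits_unique:
  assumes "S \<in> cuts" "splits S a" "T \<in> cuts" "splits T a"
  shows "S = T"
proof -
  have aux: "S \<subseteq> T" if "S \<in> cuts" "splits S a" "T \<in> cuts" "splits T a" for S T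
  proof (rule ccontr)
    assume "\<not> S \<subseteq> T"
    then have "S - T \<noteq> {}" by blast
    have "tight a ((E - S) \<union> (E - T))"
      using that splits_tight splits_imp_drac by (intro tight_Un)
    moreover have "(E - S) \<union> (E - T) = (E - S) \<union> (S - T)"
      using that by (auto simp: cuts_def)
    ultimately show False
      using splits_maximal[of S a "S - T"] that \<open>S - T \<noteq> {}\<close> by auto
  qed
  show ?thesis using aux[OF assms] aux[OF assms(3,4,1,2)] by blast
qed

text \<open>The complement of the cut is the largest tight set containing \<open>j\<close>.\<close>

lemma drac_imp_splits:
  assumes a: "drac E M I (raise a)"
  obtains S where "S \<in> cuts" "splits S a"
proof -
  \<comment> \<open>The strict bound below 1 forces \<open>F a {j} = 0\<close>, so
    \<open>{j}\<close> is tight and the family of tight sets is nonempty.\<close>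
  have "F a {j} < card {j}" using jE by (intro F_less(1)[OF a]) auto
  then have "tight a {j}" using jE by (simp add: tight_def)
  define U where "U = \<Union>{U. tight a U}"
  have UE: "U \<subseteq> E" by (auto simp: U_def tight_def)
  have "finite {U. tight a U}"
    by (rule finite_subset[of _ "Pow E"]) (auto simp: tight_def finE)
  moreover have "finite \<U> \<Longrightarrow> \<U> \<noteq> {} \<Longrightarrow> (\<forall>V\<in>\<U>. tight a V) \<Longrightarrow> tight a (\<Union>\<U>)" for \<U>
  proof (induction \<U> rule: finite_ne_induct)
    case (insert V \<U>)
    then show ?case using tight_Un[OF a] by simp
  qed simp
  ultimately have tU: "tight a U"
    using \<open>tight a {j}\<close> unfolding U_def by blast
  have max: "V \<subseteq> U" if "tight a V" for V using that by (auto simp: U_def)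
  \<comment> \<open>This makes \<open>S = E - U\<close> meet \<open>I m\<close>, as a cut
    must.\<close>
  have Im: "\<not> I m \<subseteq> U"
    using F_less(2)[OF a UE] tU by (auto simp: tight_def)
  define S where "S = E - U"
  have ES: "E - S = U" and SE: "S \<subseteq> E" using UE by (auto simp: S_def)
  have S: "S \<in> cuts" using tU Im sub[OF mM] by (auto simp: cuts_def S_def tight_def)
  have fin: "finite S" "finite U" using SE UE finE finite_subset by auto
  have cE: "card E = card S + card U"
    using card_Un_disjoint[of S U] fin UE by (simp add: S_def Un_absorb2 Diff_disjoint Int_commute)
  have sB: "sum a (avoiding M I S) + 1 = card U"
    using tU F_diff_meeting(1)[OF SE] ES by (simp add: tight_def)
  have "sum a M = sum a (meeting M I S) + sum a (avoiding M I S)"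
    using sum.union_disjoint[of "meeting M I S" "avoiding M I S" a] finM
    by (simp add: meeting_avoiding)
  then have sA: "sum a (meeting M I S) + 1 = card S"
    using sum_total[OF a] sB cE by simp
  have "(\<Sum>i | i \<in> meeting M I S \<and> I i \<inter> S \<subseteq> W. a i) < card W" if W: "W \<subseteq> S" "W \<noteq> {}" for W
  proof -
    \<comment> \<open>Beyond the largest tight set the bound is slack by at least one more;
      subtracting the equality for \<open>U\<close> leaves the strict inequality for
      \<open>W\<close> on \<open>S\<close>.\<close>
    have "\<not> tight a (U \<union> W)" using max[of "U \<union> W"] W by (auto simp: S_def)
    moreover have "F a (U \<union> W) < card (U \<union> W)"
      using W UE SE by (intro F_less(1)[OF a]) auto
    ultimately have "F a (U \<union> W) + 1 < card (U \<union> W)"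
      using tU W UE SE by (auto simp: tight_def)
    moreover have "card (U \<union> W) = card U + card W"
      using fin finite_subset[OF W(1)] W(1) by (intro card_Un_disjoint) (auto simp: S_def)
    ultimately show ?thesis
      using F_diff_meeting(2)[OF SE W(1), of a] tU unfolding ES tight_def by linarith
  qed
  moreover have "(\<Sum>i | i \<in> avoiding M I S \<and> I i \<subseteq> W. a i) < card W" if W: "W \<subseteq> E - S" "W \<noteq> {}" for W
    unfolding F_diff_meeting(3)[OF SE W(1)] using W by (intro F_less(1)[OF a]) auto
  ultimately have "splits S a"
    using sA sB by (simp add: splits_def drac_def ES)
  with S that show thesis by blast
qed

end

section \<open>The draconian sum as a function of one variable\<close>

lemma monom_val_cong:
  "(\<And>i. i \<in> M \<Longrightarrow> y i = z i) \<Longrightarrow> (\<And>i. i \<in> M \<Longrightarrow> a i = b i) \<Longrightarrow> monom_val M y a = monom_val M z b"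
  unfolding monom_val_def by (intro prod.cong) auto

lemma monom_val_nonneg: "(\<And>i. i \<in> M \<Longrightarrow> y i \<ge> 0) \<Longrightarrow> monom_val M y a \<ge> 0"
  unfolding monom_val_def by (intro prod_nonneg) auto

lemma drac_sum_cong: "(\<And>i. i \<in> M \<Longrightarrow> y i = z i) \<Longrightarrow> drac_sum E M I y = drac_sum E M I z"
  unfolding drac_sum_def by (intro sum.cong monom_val_cong) auto

lemma drac_sum_nonneg: "(\<And>i. i \<in> M \<Longrightarrow> y i \<ge> 0) \<Longrightarrow> drac_sum E M I y \<ge> 0"
  unfolding drac_sum_def by (intro sum_nonneg monom_val_nonneg) auto

lemma monom_val_remove:
  assumes "finite M" "m \<in> M"
  shows "monom_val M (y(m := v)) a = v ^ a m / fact (a m) * monom_val (M - {m}) y a"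
proof -
  have "monom_val (M - {m}) (y(m := v)) a = monom_val (M - {m}) y a"
    by (rule monom_val_cong) auto
  then show ?thesis
    using assms by (simp add: monom_val_def prod.remove)
qed

lemma drac_sum_empty: "drac_sum E {} I y = (if card E = 1 then 1 else 0)"
proof -
  have "drac E {} I a \<longleftrightarrow> card E = 1" for a
  proof -
    have "0 < card W" if "card E = 1" "W \<subseteq> E" "W \<noteq> {}" for W
      using that by (metis card_1_singletonE card_gt_0_iff finite.emptyI finite.insertI finite_subset)
    then show ?thesis by (fastforce simp: drac_def)
  qed
  then show ?thesis
    by (simp add: drac_sum_def drac_seqs_def monom_val_def)
qed

text \<open>With \<open>0 ^ 0 = 1\<close>, only the sequences with \<open>a m = 0\<close>
  contribute, and for these the index \<open>m\<close> adds nothing to any of the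
  conditions.\<close>

lemma drac_sum_insert_zero:
  assumes fin: "finite M" and m: "m \<notin> M"
  shows "drac_sum E (insert m M) I (y(m := 0)) = drac_sum E M I y"
proof -
  let ?D = "{a \<in> drac_seqs E (insert m M) I. a m = 0}"
  have dr: "drac E (insert m M) I a \<longleftrightarrow> drac E M I a" if "a m = 0" for a
  proof -
    have "(\<Sum>i | (i = m \<or> i \<in> M) \<and> I i \<subseteq> W. a i) = (\<Sum>i | i \<in> M \<and> I i \<subseteq> W. a i)" for W
      by (rule sum.mono_neutral_right) (use that fin in auto)
    then show ?thesis using that fin m by (simp add: drac_def)
  qed
  have "drac_sum E (insert m M) I (y(m := 0)) = (\<Sum>a\<in>?D. monom_val (insert m M) (y(m := 0)) a)"
    unfolding drac_sum_def
    by (rule sum.mono_neutral_right) (auto simp: finite_drac_seqs fin monom_val_remove)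
  also have "\<dots> = (\<Sum>a\<in>drac_seqs E M I. monom_val M y a)"
  proof (rule sum.reindex_bij_witness[where i = "\<lambda>a. a(m := 0)" and j = "\<lambda>a. restrict a M"])
    fix a assume a: "a \<in> ?D"
    then have ext: "a \<in> insert m M \<rightarrow>\<^sub>E UNIV" "a m = 0" by (auto simp: drac_seqs_def)
    show "(restrict a M)(m := 0) = a"
      using ext by (auto simp: fun_eq_iff PiE_iff extensional_def)
    show "restrict a M \<in> drac_seqs E M I"
      using a dr[of a] drac_cong[of M a "restrict a M" E I, THEN iffD1] by (simp add: drac_seqs_def)
    show "monom_val M y (restrict a M) = monom_val (insert m M) (y(m := 0)) a"
    proof -
      have "monom_val M y (restrict a M) = monom_val M y a" by (rule monom_val_cong) auto
      then show ?thesis using fin m ext by (simp add: monom_val_remove del: fun_upd_apply)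
    qed
  next
    fix a assume a: "a \<in> drac_seqs E M I"
    then have ext: "a \<in> M \<rightarrow>\<^sub>E UNIV" by (auto simp: drac_seqs_def)
    show "restrict (a(m := 0)) M = a"
      using ext m by (auto simp: fun_eq_iff PiE_iff extensional_def)
    have "drac E M I (a(m := 0))"
      using a m by (subst drac_cong[of M _ a]) (auto simp: drac_seqs_def)
    then show "a(m := 0) \<in> ?D"
      using ext dr[of "a(m := 0)"] by (auto simp: drac_seqs_def PiE_iff extensional_def)
  qed
  finally show ?thesis by (simp add: drac_sum_def)
qed

context drac_step
begin

text \<open>For a fixed \<open>S\<close> the two halves of \<open>M\<close> carry independent
  conditions, so a split sequence is a free pair of draconian sequences and its monomial
  factors.\<close>

lemma sum_splits:
  "(\<Sum>a | a \<in> M \<rightarrow>\<^sub>E UNIV \<and> splits S a. monom_val M y a) =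
    drac_sum S (meeting M I S) (\<lambda>i. I i \<inter> S) y * drac_sum (E - S) (avoiding M I S) I y"
proof -
  let ?A = "meeting M I S" and ?B = "avoiding M I S"
  let ?j = "\<lambda>(b, c) i. if i \<in> ?A then b i else c i"
  let ?D1 = "drac_seqs S ?A (\<lambda>i. I i \<inter> S)" and ?D2 = "drac_seqs (E - S) ?B I"
  have AB: "i \<in> M \<longleftrightarrow> i \<in> ?A \<or> i \<in> ?B" "\<not> (i \<in> ?A \<and> i \<in> ?B)" for i
    by (auto simp: meeting_def avoiding_def)
  have "drac_sum S ?A (\<lambda>i. I i \<inter> S) y * drac_sum (E - S) ?B I y =
      (\<Sum>(b, c)\<in>?D1 \<times> ?D2. monom_val ?A y b * monom_val ?B y c)"
    by (simp add: drac_sum_def sum_product sum.cartesian_product)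
  also have "\<dots> = (\<Sum>a | a \<in> M \<rightarrow>\<^sub>E UNIV \<and> splits S a. monom_val M y a)"
  proof (rule sum.reindex_bij_witness[where i = "\<lambda>a. (restrict a ?A, restrict a ?B)" and j = ?j])
    fix p assume "p \<in> ?D1 \<times> ?D2"
    then obtain b c where p: "p = (b, c)" and b: "b \<in> ?D1" and c: "c \<in> ?D2" by blast
    have ext: "b \<in> ?A \<rightarrow>\<^sub>E UNIV" "c \<in> ?B \<rightarrow>\<^sub>E UNIV" using b c by (auto simp: drac_seqs_def)
    show "(restrict (?j p) ?A, restrict (?j p) ?B) = p"
      using ext AB(2) by (auto simp: p fun_eq_iff PiE_iff extensional_def restrict_def)
    have "drac S ?A (\<lambda>i. I i \<inter> S) (?j p)"
      using b by (subst drac_cong[of ?A _ b]) (auto simp: p drac_seqs_def)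
    moreover have "drac (E - S) ?B I (?j p)"
      using c AB(2) by (subst drac_cong[of ?B _ c]) (auto simp: p drac_seqs_def)
    ultimately show "?j p \<in> {a. a \<in> M \<rightarrow>\<^sub>E UNIV \<and> splits S a}"
      using ext AB by (auto simp: splits_def p PiE_iff extensional_def)
    have "monom_val M y (?j p) = monom_val (?A \<union> ?B) y (?j p)"
      by (simp add: meeting_avoiding)
    also have "\<dots> = monom_val ?A y (?j p) * monom_val ?B y (?j p)"
      unfolding monom_val_def using finM by (intro prod.union_disjoint) (auto simp: meeting_avoiding)
    also have "monom_val ?A y (?j p) = monom_val ?A y b" by (rule monom_val_cong) (auto simp: p)
    also have "monom_val ?B y (?j p) = monom_val ?B y c"
      using AB(2) by (intro monom_val_cong) (auto simp: p)
    finally show "monom_val M y (?j p) = (case p of (b, c) \<Rightarrow> monom_val ?A y b * monom_val ?B y c)"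
      by (simp add: p)
  next
    fix a assume a: "a \<in> {a. a \<in> M \<rightarrow>\<^sub>E UNIV \<and> splits S a}"
    then show "?j (restrict a ?A, restrict a ?B) = a"
      using AB(1) by (auto simp: fun_eq_iff PiE_iff extensional_def restrict_def)
    show "(restrict a ?A, restrict a ?B) \<in> ?D1 \<times> ?D2"
      using a drac_cong[of ?A a "restrict a ?A" S "\<lambda>i. I i \<inter> S", THEN iffD1]
        drac_cong[of ?B a "restrict a ?B" "E - S" I, THEN iffD1]
      by (auto simp: drac_seqs_def splits_def)
  qed
  finally show ?thesis by simp
qed

text \<open>Existence of the splitting cut covers the index set on the left; uniqueness makes the
  covering disjoint.\<close>

lemma sum_raise_splits:
  "(\<Sum>a | a \<in> M \<rightarrow>\<^sub>E UNIV \<and> drac E M I (raise a). monom_val M y a) =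
    (\<Sum>S\<in>cuts. drac_sum S (meeting M I S) (\<lambda>i. I i \<inter> S) y * drac_sum (E - S) (avoiding M I S) I y)"
proof -
  let ?X = "{a. a \<in> M \<rightarrow>\<^sub>E UNIV \<and> drac E M I (raise a)}"
  have X: "?X = (\<Union>S\<in>cuts. {a. a \<in> M \<rightarrow>\<^sub>E UNIV \<and> splits S a})"
  proof (intro set_eqI iffI)
    fix a assume "a \<in> ?X"
    then show "a \<in> (\<Union>S\<in>cuts. {a. a \<in> M \<rightarrow>\<^sub>E UNIV \<and> splits S a})"
      using drac_imp_splits[of a] by (metis (mono_tags, lifting) UN_iff mem_Collect_eq)
  next
    fix a assume "a \<in> (\<Union>S\<in>cuts. {a. a \<in> M \<rightarrow>\<^sub>E UNIV \<and> splits S a})"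
    then show "a \<in> ?X" using splits_imp_drac by blast
  qed
  have "?X \<subseteq> M \<rightarrow>\<^sub>E {..card E}"
  proof
    fix a assume a: "a \<in> ?X"
    then have "sum a M \<le> card E" using sum_total[of a] by simp
    then have "a i \<le> card E" if "i \<in> M" for i
      using that member_le_sum[of i M a] finM by fastforce
    then show "a \<in> M \<rightarrow>\<^sub>E {..card E}" using a by (auto simp: PiE_iff)
  qed
  then have fin: "finite ?X" by (rule finite_subset) (simp add: finM finite_PiE)
  have "(\<Sum>a\<in>?X. monom_val M y a) =
      (\<Sum>S\<in>cuts. \<Sum>a | a \<in> M \<rightarrow>\<^sub>E UNIV \<and> splits S a. monom_val M y a)"
    unfolding X
  proof (rule sum.UNION_disjoint)
    show "\<forall>S\<in>cuts. finite {a. a \<in> M \<rightarrow>\<^sub>E UNIV \<and> splits S a}"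
      using splits_imp_drac by (auto intro!: finite_subset[OF _ fin])
  qed (use finite_cuts splits_unique in auto)
  then show ?thesis by (simp add: sum_splits)
qed

text \<open>The normalization by factorials makes the derivative of a monomial the monomial with its
  exponent at \<open>m\<close> lowered; the surviving sequences are then grouped by their
  cut.\<close>

lemma drac_sum_deriv:
  "((\<lambda>v. drac_sum E M I (y(m := v))) has_real_derivative
    (\<Sum>S\<in>cuts. drac_sum S (meeting M I S) (\<lambda>i. I i \<inter> S) (y(m := v)) *
       drac_sum (E - S) (avoiding M I S) I y)) (at v)"
proof -
  let ?D = "drac_seqs E M I" and ?c = "monom_val (M - {m}) y"
  let ?X = "{a. a \<in> M \<rightarrow>\<^sub>E UNIV \<and> drac E M I (raise a)}"
  let ?d = "\<lambda>a. (if a m = 0 then 0 else v ^ (a m - 1) / fact (a m - 1)) * ?c a"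
  have "((\<lambda>v. v ^ k / fact k) has_real_derivative (if k = 0 then 0 else v ^ (k - 1) / fact (k - 1))) (at v)" for k
    using DERIV_cdivide[OF DERIV_pow[of k v], of "fact k"] by (cases k) simp_all
  then have der: "((\<lambda>v. drac_sum E M I (y(m := v))) has_real_derivative (\<Sum>a\<in>?D. ?d a)) (at v)"
    unfolding drac_sum_def monom_val_remove[OF finM mM]
    by (intro DERIV_sum DERIV_cmult_right)
  have "(\<Sum>a\<in>?D. ?d a) = (\<Sum>a | a \<in> ?D \<and> a m \<noteq> 0. ?d a)"
    by (rule sum.mono_neutral_right) (auto simp: finite_drac_seqs finM)
  also have "\<dots> = (\<Sum>a\<in>?X. monom_val M (y(m := v)) a)"
  proof (rule sum.reindex_bij_witness[where i = raise and j = "\<lambda>a. a(m := a m - 1)"])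
    fix a assume a: "a \<in> {a. a \<in> ?D \<and> a m \<noteq> 0}"
    then show *: "raise (a(m := a m - 1)) = a" by (auto simp: raise_def)
    show "a(m := a m - 1) \<in> ?X"
      using a * mM by (auto simp: drac_seqs_def PiE_iff extensional_def)
    have "?c (a(m := a m - 1)) = ?c a" by (rule monom_val_cong) auto
    then show "monom_val M (y(m := v)) (a(m := a m - 1)) = ?d a"
      using a by (simp add: monom_val_remove[OF finM mM])
  next
    fix a assume a: "a \<in> ?X"
    then show "(raise a)(m := raise a m - 1) = a" by (auto simp: raise_def)
    show "raise a \<in> {a. a \<in> ?D \<and> a m \<noteq> 0}"
      using a mM by (auto simp: drac_seqs_def raise_def PiE_iff extensional_def)
  qed
  also have "\<dots> = (\<Sum>S\<in>cuts. drac_sum S (meeting M I S) (\<lambda>i. I i \<inter> S) (y(m := v)) *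
       drac_sum (E - S) (avoiding M I S) I y)"
    unfolding sum_raise_splits
  proof (rule sum.cong)
    fix S assume "S \<in> cuts"
    \<comment> \<open>A cut meets \<open>I m\<close>, so the factor on \<open>E - S\<close> is
      constant in the variable \<open>v\<close>.\<close>
    then have "m \<notin> avoiding M I S" by (auto simp: cuts_def avoiding_def)
    then have "drac_sum (E - S) (avoiding M I S) I (y(m := v)) = drac_sum (E - S) (avoiding M I S) I y"
      by (intro drac_sum_cong) auto
    then show "drac_sum S (meeting M I S) (\<lambda>i. I i \<inter> S) (y(m := v)) *
        drac_sum (E - S) (avoiding M I S) I (y(m := v)) =
      drac_sum S (meeting M I S) (\<lambda>i. I i \<inter> S) (y(m := v)) * drac_sum (E - S) (avoiding M I S) I y"
      by simp
  qed simp
  finally show ?thesis using der by simp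
qed

end

section \<open>Integration over coordinates and base polytopes\<close>

interpretation lborel_prod: product_sigma_finite "\<lambda>_. lborel :: real measure"
  by standard

abbreviation lebesgue_on_coords :: "'b set \<Rightarrow> ('b \<Rightarrow> real) measure" where
  "lebesgue_on_coords A \<equiv> Pi\<^sub>M A (\<lambda>_. lborel)"

lemma fun_upd_measurable_PiM [measurable (raw)]:
  assumes "f \<in> N \<rightarrow>\<^sub>M Pi\<^sub>M (A - {l}) (\<lambda>_. lborel :: real measure)" "h \<in> borel_measurable N" "l \<in> A"
  shows "(\<lambda>x. (f x)(l := h x)) \<in> N \<rightarrow>\<^sub>M Pi\<^sub>M A (\<lambda>_. lborel)"
  using assms by (intro measurable_fun_upd[where J = "A - {l}"]) auto

lemma sum_coords_measurable [measurable]: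
  "W \<subseteq> A \<Longrightarrow> (\<lambda>x. sum x W) \<in> borel_measurable (lebesgue_on_coords A)"
  by (intro borel_measurable_sum) (simp add: subset_iff)

text \<open>Slices space by the coordinate sum: the coordinate \<open>l\<close> is replaced by
  \<open>v\<close>, the total minus \<open>c\<close>, through a translation in \<open>l\<close> for
  fixed other coordinates. Hence the slices carry exactly the measure used in
  \<open>base_vol\<close>.\<close>

lemma nn_integral_coords_sum:
  fixes c :: real
  assumes fin: "finite A" and l: "l \<in> A" and G [measurable]: "G \<in> borel_measurable (lebesgue_on_coords A)"
  shows "(\<integral>\<^sup>+x. G x \<partial>lebesgue_on_coords A) =
    (\<integral>\<^sup>+v. \<integral>\<^sup>+w. G (w(l := c + v - sum w (A - {l}))) \<partial>lebesgue_on_coords (A - {l}) \<partial>lborel)"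
proof -
  let ?L = "lebesgue_on_coords (A - {l})"
  have A: "insert l (A - {l}) = A" using l by blast
  have *: "(\<lambda>(w, v). G (w(l := c + v - sum w (A - {l})))) \<in> borel_measurable (?L \<Otimes>\<^sub>M lborel)"
    using l by measurable
  have "(\<integral>\<^sup>+x. G x \<partial>lebesgue_on_coords A) = (\<integral>\<^sup>+w. \<integral>\<^sup>+u. G (w(l := u)) \<partial>lborel \<partial>?L)"
    using lborel_prod.product_nn_integral_insert[of "A - {l}" l G] fin G by (simp add: insert_absorb[OF l])
  also have "\<dots> = (\<integral>\<^sup>+w. \<integral>\<^sup>+v. G (w(l := c + v - sum w (A - {l}))) \<partial>lborel \<partial>?L)"
  proof (rule nn_integral_cong)
    fix w assume w: "w \<in> space ?L"
    have "(\<lambda>u. w(l := u)) \<in> borel \<rightarrow>\<^sub>M lebesgue_on_coords A"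
      using w l by (intro fun_upd_measurable_PiM measurable_const) auto
    then have "(\<lambda>u. G (w(l := u))) \<in> borel_measurable borel"
      by (rule measurable_compose) (rule G)
    then show "(\<integral>\<^sup>+u. G (w(l := u)) \<partial>lborel) = (\<integral>\<^sup>+v. G (w(l := c + v - sum w (A - {l}))) \<partial>lborel)"
      by (subst nn_integral_real_affine[where c = 1 and t = "c - sum w (A - {l})"])
         (auto simp: algebra_simps)
  qed
  also have "\<dots> = (\<integral>\<^sup>+v. \<integral>\<^sup>+w. G (w(l := c + v - sum w (A - {l}))) \<partial>?L \<partial>lborel)"
    using * by (intro pair_sigma_finite.Fubini'[symmetric])
      (auto simp: pair_sigma_finite_def fin lborel.sigma_finite_measure_axioms intro: lborel_prod.sigma_finite)
  finally show ?thesis .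
qed

lemma AE_coord_neq:
  assumes fin: "finite A" and l: "l \<in> A" and [measurable]: "\<phi> \<in> borel_measurable (lebesgue_on_coords A)"
    and \<phi>: "\<And>x u. \<phi> (x(l := u)) = \<phi> x"
  shows "AE x in lebesgue_on_coords A. x l \<noteq> \<phi> x"
proof -
  let ?L = "lebesgue_on_coords (A - {l})"
  let ?G = "\<lambda>x. if x l = \<phi> x then 1 else 0 :: ennreal"
  have A: "insert l (A - {l}) = A" using l by blast
  have G [measurable]: "?G \<in> borel_measurable (lebesgue_on_coords A)" using l by measurable
  have "(\<integral>\<^sup>+x. ?G x \<partial>lebesgue_on_coords A) = (\<integral>\<^sup>+w. \<integral>\<^sup>+u. ?G (w(l := u)) \<partial>lborel \<partial>?L)"
    using lborel_prod.product_nn_integral_insert[of "A - {l}" l ?G] fin G by (simp add: insert_absorb[OF l])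
  also have "\<dots> = (\<integral>\<^sup>+w. \<integral>\<^sup>+u. indicator {\<phi> w} u \<partial>lborel \<partial>?L)"
    by (intro nn_integral_cong) (simp add: \<phi>)
  also have "\<dots> = 0" by simp
  finally have "AE x in lebesgue_on_coords A. ?G x = 0"
    by (subst (asm) nn_integral_0_iff_AE) auto
  then show ?thesis by eventually_elim (auto split: if_splits)
qed

text \<open>Some coordinate occurs in just one of the two sums, and equality would determine it from
  the others: a graph, which is null. This excludes ties between two moving constraints.\<close>

lemma AE_sum_neq:
  fixes c d :: real
  assumes fin: "finite A" and "S \<subseteq> A" "T \<subseteq> A" "S \<noteq> T"
  shows "AE x in lebesgue_on_coords A. sum x S - c \<noteq> sum x T - d"
proof -
  have aux: "AE x in lebesgue_on_coords A. sum x S - c \<noteq> sum x T - d"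
    if ST: "S \<subseteq> A" "T \<subseteq> A" and l: "l \<in> S" "l \<notin> T" for S T l and c d :: real
  proof -
    have "AE x in lebesgue_on_coords A. x l \<noteq> sum x T - d + c - sum x (S - {l})"
    proof (rule AE_coord_neq[OF fin])
      show "(\<lambda>x. sum x T - d + c - sum x (S - {l})) \<in> borel_measurable (lebesgue_on_coords A)"
        by (intro borel_measurable_diff borel_measurable_add sum_coords_measurable) (use ST in auto)
      fix x :: "'a \<Rightarrow> real" and u
      have "sum (x(l := u)) T = sum x T" "sum (x(l := u)) (S - {l}) = sum x (S - {l})"
        using l by (auto intro!: sum.cong)
      then show "sum (x(l := u)) T - d + c - sum (x(l := u)) (S - {l}) = sum x T - d + c - sum x (S - {l})"
        by simp
    qed (use ST l in auto)
    moreover have "sum x S = x l + sum x (S - {l})" for x :: "'a \<Rightarrow> real"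
      using l ST finite_subset[OF _ fin] by (metis sum.remove)
    ultimately show ?thesis by (auto elim!: eventually_mono simp: algebra_simps)
  qed
  consider l where "l \<in> S" "l \<notin> T" | l where "l \<in> T" "l \<notin> S" using assms(4) by blast
  then show ?thesis
  proof cases
    case 1
    then show ?thesis using aux assms by blast
  next
    case 2
    then have "AE x in lebesgue_on_coords A. sum x T - d \<noteq> sum x S - c" using aux assms by blast
    then show ?thesis by eventually_elim auto
  qed
qed

section \<open>Base polytopes and their volume after dropping a coordinate\<close>

definition cut_sum :: "'a set \<Rightarrow> ('a \<Rightarrow> 'b set) \<Rightarrow> ('a \<Rightarrow> real) \<Rightarrow> 'b set \<Rightarrow> real" where
  "cut_sum M I y S = sum y (meeting M I S)"

definition base_polytope ::
    "'b set \<Rightarrow> 'a set \<Rightarrow> ('a \<Rightarrow> 'b set) \<Rightarrow> ('a \<Rightarrow> real) \<Rightarrow> ('b \<Rightarrow> real) \<Rightarrow> bool" where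
  "base_polytope E M I y t \<longleftrightarrow> sum t E = sum y M \<and> (\<forall>W\<in>Pow E. sum t W \<le> cut_sum M I y W)"

text \<open>Coordinate \<open>k\<close> is recovered from the total. Values in
  \<open>ennreal\<close> allow Fubini and sums without proving finiteness beforehand.\<close>

definition base_vol :: "'b set \<Rightarrow> 'b \<Rightarrow> 'a set \<Rightarrow> ('a \<Rightarrow> 'b set) \<Rightarrow> ('a \<Rightarrow> real) \<Rightarrow> ennreal" where
  "base_vol E k M I y =
    (\<integral>\<^sup>+x. (if base_polytope E M I y (x(k := sum y M - sum x (E - {k}))) then 1 else 0)
      \<partial>lebesgue_on_coords (E - {k}))"

text \<open>The weights \<open>z x\<close> may vary with the point as well, because
  \<open>y m\<close> will be replaced by the gap of the point.\<close>

lemma base_polytope_measurable [measurable (raw)]: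
  assumes fin: "finite E" "finite M"
    and f: "\<And>i. i \<in> E \<Longrightarrow> (\<lambda>x. f x i) \<in> borel_measurable N"
    and z: "\<And>i. i \<in> M \<Longrightarrow> (\<lambda>x. z x i) \<in> borel_measurable N"
  shows "Measurable.pred N (\<lambda>x. base_polytope E M I (z x) (f x))"
proof -
  have [measurable]: "(\<lambda>x. sum (f x) W) \<in> borel_measurable N" if "W \<subseteq> E" for W
    using that f by (intro borel_measurable_sum) auto
  have [measurable]: "(\<lambda>x. sum (z x) K) \<in> borel_measurable N" if "K \<subseteq> M" for K
    using that z by (intro borel_measurable_sum) auto
  have "Measurable.pred N (\<lambda>x. sum (f x) W \<le> cut_sum M I (z x) W)" if "W \<in> Pow E" for W
  proof -
    have [measurable]: "(\<lambda>x. sum (f x) W) \<in> borel_measurable N"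
      "(\<lambda>x. sum (z x) (meeting M I W)) \<in> borel_measurable N"
      using that by (auto simp: meeting_def)
    show ?thesis unfolding cut_sum_def by measurable
  qed
  moreover have "Measurable.pred N (\<lambda>x. sum (f x) E = sum (z x) M)"
    by measurable
  ultimately show ?thesis
    unfolding base_polytope_def using fin by (intro pred_intros_logic pred_intros_finite) auto
qed

lemma fill_measurable:
  fixes h :: "'c \<Rightarrow> real"
  assumes x: "f \<in> N \<rightarrow>\<^sub>M lebesgue_on_coords A" and h: "h \<in> borel_measurable N" and i: "i \<in> insert k A"
  shows "(\<lambda>x. ((f x)(k := h x)) i) \<in> borel_measurable N"
proof (cases "i = k")
  case False
  then have "(\<lambda>x. f x i) \<in> N \<rightarrow>\<^sub>M lborel"
    using x i measurable_compose[OF x measurable_component_singleton[of i A "\<lambda>_. lborel"]] by auto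
  then show ?thesis using False by simp
qed (use h in simp)

lemma base_polytope_fill_measurable:
  assumes "finite E" "finite M" "k \<in> E"
  shows "Measurable.pred (lebesgue_on_coords (E - {k}))
    (\<lambda>x. base_polytope E M I y (x(k := c - sum x (E - {k}))))"
  using assms by (intro base_polytope_measurable fill_measurable[where A = "E - {k}"]) auto

lemma base_polytope_cong:
  assumes "\<And>i. i \<in> E \<Longrightarrow> s i = t i" "\<And>i. i \<in> M \<Longrightarrow> y i = z i"
  shows "base_polytope E M I y s \<longleftrightarrow> base_polytope E M I z t"
proof -
  have "sum s W = sum t W" if "W \<subseteq> E" for W using that assms by (intro sum.cong) auto
  moreover have "sum y K = sum z K" if "K \<subseteq> M" for K using that assms by (intro sum.cong) auto
  ultimately show ?thesis by (simp add: base_polytope_def cut_sum_def meeting_def)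
qed

text \<open>With all coordinates but \<open>k\<close> and \<open>l\<close> fixed, these two have a
  constant sum; exchanging which one is free is a reflection of the line. The induction relies on
  this to move the dropped coordinate to \<open>j\<close>.\<close>

lemma base_vol_indep:
  assumes fin: "finite E" "finite M" and k: "k \<in> E" and l: "l \<in> E"
  shows "base_vol E k M I y = base_vol E l M I y"
proof (cases "k = l")
  case False
  let ?R = "E - {k, l}"
  let ?P = "\<lambda>t. if base_polytope E M I y t then 1 else 0 :: ennreal"
  have aux: "base_vol E k M I y =
      (\<integral>\<^sup>+w. \<integral>\<^sup>+u. ?P (w(l := u, k := sum y M - sum w ?R - u)) \<partial>lborel \<partial>lebesgue_on_coords ?R)"
    if k: "k \<in> E" and l: "l \<in> E" and kl: "k \<noteq> l" and R: "?R = E - {k, l}" for k l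
  proof -
    have E: "E - {k} = insert l ?R" using kl l R by auto
    have "(\<lambda>x. ?P (x(k := sum y M - sum x (E - {k})))) \<in> borel_measurable (lebesgue_on_coords (E - {k}))"
      using base_polytope_fill_measurable[OF fin k] by measurable
    then have "base_vol E k M I y =
      (\<integral>\<^sup>+w. \<integral>\<^sup>+u. ?P (w(l := u, k := sum y M - sum (w(l := u)) (insert l ?R))) \<partial>lborel \<partial>lebesgue_on_coords ?R)"
      unfolding base_vol_def E using fin R
      by (subst lborel_prod.product_nn_integral_insert) auto
    moreover have "sum (w(l := u)) (insert l ?R) = u + sum w ?R" for w :: "_ \<Rightarrow> real" and u
    proof -
      have "sum (w(l := u)) ?R = sum w ?R" using R by (intro sum.cong) auto
      then show ?thesis using fin R by simp
    qed
    ultimately show ?thesis by (simp add: algebra_simps)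
  qed
  have "(\<integral>\<^sup>+u. ?P (w(l := u, k := sum y M - sum w ?R - u)) \<partial>lborel) =
      (\<integral>\<^sup>+u. ?P (w(k := u, l := sum y M - sum w ?R - u)) \<partial>lborel)" for w
  proof -
    have "(\<lambda>u. ?P (w(l := u, k := sum y M - sum w ?R - u))) \<in> borel_measurable borel"
    proof -
      have "(\<lambda>u. (w(l := u, k := sum y M - sum w ?R - u)) i) \<in> borel_measurable borel" for i
        by (cases "i = k"; cases "i = l") auto
      then have "Measurable.pred borel (\<lambda>u. base_polytope E M I y (w(l := u, k := sum y M - sum w ?R - u)))"
        by (intro base_polytope_measurable fin) auto
      then show ?thesis by measurable
    qed
    then have "(\<integral>\<^sup>+u. ?P (w(l := u, k := sum y M - sum w ?R - u)) \<partial>lborel) =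
      (\<integral>\<^sup>+u. ?P (w(l := sum y M - sum w ?R - u, k := sum y M - sum w ?R - (sum y M - sum w ?R - u))) \<partial>lborel)"
      by (subst nn_integral_real_affine[where c = "-1" and t = "sum y M - sum w ?R"]) simp_all
    also have "\<dots> = (\<integral>\<^sup>+u. ?P (w(k := u, l := sum y M - sum w ?R - u)) \<partial>lborel)"
      using False by (simp add: fun_upd_twist)
    finally show ?thesis .
  qed
  moreover have "?R = E - {l, k}" by blast
  ultimately show ?thesis
    using aux[OF k l False refl] aux[OF l k False[symmetric]] by simp
qed simp

section \<open>Growth of the volume\<close>

lemma cut_sum_meeting:
  "W \<subseteq> S \<Longrightarrow> cut_sum (meeting M I S) (\<lambda>i. I i \<inter> S) y W = cut_sum M I y W"
  unfolding cut_sum_def by (rule sum.cong) (auto simp: meeting_def)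

lemma cut_sum_avoiding:
  assumes "finite M"
  shows "cut_sum (avoiding M I S) I y W + cut_sum M I y S = cut_sum M I y (W \<union> S)"
proof -
  have "meeting M I (W \<union> S) = meeting (avoiding M I S) I W \<union> meeting M I S"
    and "meeting (avoiding M I S) I W \<inter> meeting M I S = {}"
    by (auto simp: meeting_def avoiding_def)
  then show ?thesis
    using assms by (simp add: cut_sum_def sum.union_disjoint)
qed

lemma cut_sum_split_le:
  assumes "finite M" "\<And>i. i \<in> M \<Longrightarrow> y i \<ge> 0"
  shows "cut_sum (meeting M I S) (\<lambda>i. I i \<inter> S) y (W \<inter> S) + cut_sum (avoiding M I S) I y (W - S)
    \<le> cut_sum M I y W"
proof -
  let ?A = "meeting (meeting M I S) (\<lambda>i. I i \<inter> S) (W \<inter> S)"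
    and ?B = "meeting (avoiding M I S) I (W - S)"
  have "?A \<inter> ?B = {}"
    by (auto simp: meeting_def avoiding_def)
  then have "cut_sum (meeting M I S) (\<lambda>i. I i \<inter> S) y (W \<inter> S) + cut_sum (avoiding M I S) I y (W - S)
      = sum y (?A \<union> ?B)"
    using assms(1) by (simp add: cut_sum_def sum.union_disjoint)
  also have "\<dots> \<le> sum y (meeting M I W)"
    using assms by (intro sum_mono2) (auto simp: meeting_def avoiding_def)
  finally show ?thesis by (simp add: cut_sum_def)
qed

text \<open>Subtracting the equality for \<open>S\<close> from the inequality for
  \<open>W \<union> S\<close> gives the constraints on \<open>E - S\<close>. Conversely a set is cut
  into its parts inside and outside \<open>S\<close>; no index is counted twice, and nonnegative
  weights give the bound.\<close>

lemma base_polytope_facet: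
  assumes "finite E" "finite M" "S \<subseteq> E" "\<And>i. i \<in> M \<Longrightarrow> y i \<ge> 0"
  shows "base_polytope E M I y t \<and> sum t S = cut_sum M I y S \<longleftrightarrow>
    base_polytope S (meeting M I S) (\<lambda>i. I i \<inter> S) y t \<and>
    base_polytope (E - S) (avoiding M I S) I y t" (is "?L \<longleftrightarrow> ?R")
proof -
  have yM: "sum y M = cut_sum M I y S + sum y (avoiding M I S)"
    using sum.union_disjoint[of "meeting M I S" "avoiding M I S" y] assms(2)
    by (simp add: meeting_avoiding cut_sum_def)
  have tW: "sum t W = sum t (W \<inter> S) + sum t (W - S)" if "W \<subseteq> E" for W
    using sum.Int_Diff[OF finite_subset[OF that assms(1)]] by blast
  have tE: "sum t E = sum t S + sum t (E - S)"
    using tW[of E] assms(3) by (simp add: Int_absorb1)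
  show ?thesis
  proof
    assume L: ?L
    have "sum t W \<le> cut_sum (avoiding M I S) I y W" if "W \<subseteq> E - S" for W
    proof -
      have "sum t (W \<union> S) \<le> cut_sum M I y (W \<union> S)"
        using L that assms(3) by (auto simp: base_polytope_def)
      moreover have "sum t (W \<union> S) = sum t W + sum t S"
        using that finite_subset[OF assms(3,1)] finite_subset[OF that] assms(1)
        by (intro sum.union_disjoint) auto
      ultimately show ?thesis using cut_sum_avoiding[OF assms(2), of I S y W] L by linarith
    qed
    moreover have "sum t W \<le> cut_sum (meeting M I S) (\<lambda>i. I i \<inter> S) y W" if "W \<subseteq> S" for W
      using L that assms(3) unfolding cut_sum_meeting[OF that] base_polytope_def by blast
    ultimately show ?R
      using L yM tE by (simp add: base_polytope_def cut_sum_def[of M I y S])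
  next
    assume R: ?R
    have S: "sum t S = cut_sum M I y S" using R by (simp add: base_polytope_def cut_sum_def)
    have "sum t W \<le> cut_sum M I y W" if W: "W \<subseteq> E" for W
    proof -
      have "sum t (W \<inter> S) \<le> cut_sum (meeting M I S) (\<lambda>i. I i \<inter> S) y (W \<inter> S)"
        and "sum t (W - S) \<le> cut_sum (avoiding M I S) I y (W - S)"
        using R W unfolding base_polytope_def by blast+
      then show ?thesis
        using cut_sum_split_le[of M y I S W] assms(2,4) tW[OF W] by simp
    qed
    then show ?L using R S tE yM by (auto simp: base_polytope_def)
  qed
qed

section \<open>Constraints that move with the last weight, and the layers they sweep out\<close>

context drac_step
begin

text \<open>Only coordinate \<open>j\<close> depends on \<open>v\<close>, so a fixed
  \<open>x\<close> parametrizes the translated polytopes for all \<open>v\<close> at once.\<close>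

definition point :: "('a \<Rightarrow> real) \<Rightarrow> real \<Rightarrow> ('b \<Rightarrow> real) \<Rightarrow> 'b \<Rightarrow> real" where
  "point y v x = x(j := sum y (M - {m}) + v - sum x (E - {j}))"

text \<open>The value of \<open>y m\<close> from which on the constraint of the cut \<open>S\<close>
  holds at \<open>x\<close>; it may be negative.\<close>

definition gap :: "('a \<Rightarrow> real) \<Rightarrow> 'b set \<Rightarrow> ('b \<Rightarrow> real) \<Rightarrow> real" where
  "gap y S x = sum x S - cut_sum (M - {m}) I y S"

lemma sum_upd_total: "sum (y(m := v)) M = sum y (M - {m}) + v" for v :: real
proof -
  have "sum (y(m := v)) M = v + sum (y(m := v)) (M - {m})"
    using finM mM by (simp add: sum.remove)
  also have "sum (y(m := v)) (M - {m}) = sum y (M - {m})" by (rule sum.cong) auto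
  finally show ?thesis by simp
qed

lemma cut_sum_upd:
  "cut_sum M I (y(m := v)) W = cut_sum (M - {m}) I y W + (if I m \<inter> W \<noteq> {} then v else 0)"
proof (cases "I m \<inter> W = {}")
  case True
  then show ?thesis by (auto simp: cut_sum_def meeting_def intro!: sum.cong)
next
  case False
  then have "meeting M I W = insert m (meeting (M - {m}) I W)" "m \<notin> meeting (M - {m}) I W"
    using mM by (auto simp: meeting_def)
  moreover have "sum (y(m := v)) (meeting (M - {m}) I W) = sum y (meeting (M - {m}) I W)"
    by (rule sum.cong) (auto simp: meeting_def)
  ultimately show ?thesis using False finM by (simp add: cut_sum_def)
qed

lemma sum_point_cut: "S \<in> cuts \<Longrightarrow> sum (point y v x) S = sum x S"
  unfolding point_def by (rule sum.cong) (auto simp: cuts_def)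

lemma sum_point_total: "sum (point y v x) E = sum y (M - {m}) + v"
proof -
  have "sum (point y v x) (E - {j}) = sum x (E - {j})"
    by (rule sum.cong) (auto simp: point_def)
  then show ?thesis
    using finE jE sum.remove[of E j "point y v x"] by (simp add: point_def)
qed

lemma sum_point:
  assumes "W \<subseteq> E"
  shows "sum (point y v x) W = sum (point y 0 x) W + (if j \<in> W then v else 0)"
proof (cases "j \<in> W")
  case True
  have "sum (point y v x) (W - {j}) = sum (point y 0 x) (W - {j})"
    by (rule sum.cong) (auto simp: point_def)
  then show ?thesis
    using True finite_subset[OF assms finE] sum.remove[of W j "point y v x"] sum.remove[of W j "point y 0 x"]
    by (simp add: point_def)
next
  case False
  then show ?thesis by (auto simp: point_def intro!: sum.cong)
qed

text \<open>The constraints that do not move: if \<open>j \<in> W\<close>, both sides grow by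
  \<open>v\<close>, and if \<open>W\<close> misses \<open>I m\<close>, both stay fixed. Hence they
  may be stated at \<open>v = 0\<close>.\<close>

definition uncut :: "('a \<Rightarrow> real) \<Rightarrow> ('b \<Rightarrow> real) \<Rightarrow> bool" where
  "uncut y x \<longleftrightarrow> (\<forall>W\<in>Pow E - cuts. sum (point y 0 x) W \<le> cut_sum (M - {m}) I y W)"

lemma Pow_split: "(\<forall>W\<in>Pow E. P W) \<longleftrightarrow> (\<forall>W\<in>Pow E - cuts. P W) \<and> (\<forall>W\<in>cuts. P W)"
proof -
  have "cuts \<subseteq> Pow E" by (auto simp: cuts_def)
  then show ?thesis by (meson DiffD1 DiffI subsetD)
qed

lemma base_polytope_point:
  "base_polytope E M I (y(m := v)) (point y v x) \<longleftrightarrow> uncut y x \<and> (\<forall>S\<in>cuts. gap y S x \<le> v)"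
proof -
  have "sum (point y v x) W \<le> cut_sum M I (y(m := v)) W \<longleftrightarrow>
      sum (point y 0 x) W \<le> cut_sum (M - {m}) I y W" if "W \<in> Pow E - cuts" for W
    using that jm sum_point[of W y v x] by (auto simp: cut_sum_upd cuts_def)
  moreover have "sum (point y v x) S \<le> cut_sum M I (y(m := v)) S \<longleftrightarrow> gap y S x \<le> v" if "S \<in> cuts" for S
    using that by (auto simp: cut_sum_upd sum_point_cut gap_def) (auto simp: cuts_def)
  ultimately show ?thesis
    unfolding uncut_def base_polytope_def Pow_split by (simp add: sum_upd_total sum_point_total del: fun_upd_apply)
qed

lemma base_polytope_point_zero:
  "base_polytope E (M - {m}) I y (point y 0 x) \<longleftrightarrow> uncut y x \<and> (\<forall>S\<in>cuts. gap y S x \<le> 0)"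
  unfolding uncut_def base_polytope_def Pow_split by (simp add: sum_point_total sum_point_cut gap_def)

lemma upd_measurable: "f \<in> borel_measurable K \<Longrightarrow> (\<lambda>x. (y(m := f x)) i) \<in> borel_measurable K"
  for f :: "'d \<Rightarrow> real"
  by (cases "i = m") auto

lemma base_polytope_point_measurable:
  assumes f: "f \<in> borel_measurable (lebesgue_on_coords (E - {j}))"
  shows "Measurable.pred (lebesgue_on_coords (E - {j}))
    (\<lambda>x. base_polytope E M I (y(m := f x)) (point y (f x) x))"
  unfolding point_def using jE f
  by (intro base_polytope_measurable fill_measurable[where A = "E - {j}"] upd_measurable finE finM
      borel_measurable_diff borel_measurable_add sum_coords_measurable) auto

text \<open>An uncut \<open>x\<close> belongs to the region at time \<open>v\<close> exactly from
  its largest gap on. Either this gap is at most 0 (first term), or it lies in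
  \<open>{0<..Y}\<close> and the summand of the cut attaining it is 1. Without ties only one cut
  attains it.\<close>

lemma base_polytope_layers:
  assumes gen: "\<And>S T. S \<in> cuts \<Longrightarrow> T \<in> cuts \<Longrightarrow> S \<noteq> T \<Longrightarrow> gap y S x \<noteq> gap y T x" and Y: "Y \<ge> 0"
  shows "(if base_polytope E M I (y(m := Y)) (point y Y x) then 1 else 0 :: ennreal) =
    (if base_polytope E (M - {m}) I y (point y 0 x) then 1 else 0) +
    (\<Sum>S\<in>cuts. if 0 < gap y S x \<and> gap y S x \<le> Y \<and>
       base_polytope E M I (y(m := gap y S x)) (point y (gap y S x) x) then 1 else 0)"
proof -
  note N = base_polytope_point base_polytope_point_zero
  show ?thesis
  proof (cases "cuts = {} \<or> \<not> uncut y x")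
    case True
    then show ?thesis unfolding N by auto
  next
    case False
    let ?g = "(\<lambda>S. gap y S x) ` cuts"
    have "Max ?g \<in> ?g" using False finite_cuts by (intro Max_in) auto
    then obtain Z where "Z \<in> cuts" "gap y Z x = Max ?g" by auto
    then have Z: "Z \<in> cuts" "\<And>S. S \<in> cuts \<Longrightarrow> gap y S x \<le> gap y Z x"
      using finite_cuts by auto
    have all: "(\<forall>S\<in>cuts. gap y S x \<le> v) \<longleftrightarrow> gap y Z x \<le> v" for v
      using Z by force
    have uniq: "gap y Z x \<le> gap y S x \<longleftrightarrow> S = Z" if "S \<in> cuts" for S
      using gen[OF that Z(1)] Z(2)[OF that] by force
    have "(\<Sum>S\<in>cuts. if 0 < gap y S x \<and> gap y S x \<le> Y \<and> gap y Z x \<le> gap y S x then 1 else 0 :: ennreal) =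
        (\<Sum>S\<in>cuts. if S = Z then if 0 < gap y Z x \<and> gap y Z x \<le> Y then 1 else 0 else 0)"
      by (rule sum.cong) (auto simp: uniq)
    also have "\<dots> = (if 0 < gap y Z x \<and> gap y Z x \<le> Y then 1 else 0)"
      using finite_cuts Z by simp
    finally show ?thesis
      using False Y unfolding N all by auto
  qed
qed

text \<open>At the time \<open>gap y S x\<close> the point lies on the face of \<open>S\<close>,
  which is a product. The gap depends only on the coordinates in \<open>S\<close>, so Fubini
  separates the factors, and slicing the first by the gap gives the integral over
  \<open>v\<close>.\<close>

lemma base_vol_layer:
  assumes y: "\<And>i. i \<in> M \<Longrightarrow> y i \<ge> 0" and S: "S \<in> cuts" and l: "l \<in> S"
  shows "(\<integral>\<^sup>+x. (if 0 < gap y S x \<and> gap y S x \<le> Y \<and>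
       base_polytope E M I (y(m := gap y S x)) (point y (gap y S x) x) then 1 else 0)
       \<partial>lebesgue_on_coords (E - {j})) =
    (\<integral>\<^sup>+v. indicator {0<..Y} v * base_vol S l (meeting M I S) (\<lambda>i. I i \<inter> S) (y(m := v)) \<partial>lborel)
    * base_vol (E - S) j (avoiding M I S) I y"
proof -
  let ?T = "E - S - {j}" and ?c = "cut_sum (M - {m}) I y S"
  let ?A = "\<lambda>v. base_polytope S (meeting M I S) (\<lambda>i. I i \<inter> S) (y(m := v))"
  let ?B = "base_polytope (E - S) (avoiding M I S) I y"
  let ?G = "\<lambda>x. if 0 < gap y S x \<and> gap y S x \<le> Y \<and> ?A (gap y S x) x then 1 else 0 :: ennreal"
  let ?H = "\<lambda>z. if ?B (z(j := sum y (avoiding M I S) - sum z ?T)) then 1 else 0 :: ennreal"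
  have SE: "S \<subseteq> E" "j \<notin> S" "S \<inter> I m \<noteq> {}" and finS: "finite S"
    using S finE by (auto simp: cuts_def intro: finite_subset)
  have SEj: "S \<subseteq> E - {j}" using SE by blast
  have ST: "S \<union> ?T = E - {j}" "S \<inter> ?T = {}" using SE by auto
  have mA: "m \<in> meeting M I S" "m \<notin> avoiding M I S"
    using SE mM by (auto simp: meeting_def avoiding_def)
  \<comment> \<open>Once \<open>S\<close> has received its full share, the total left for
    \<open>E - S\<close> does not involve \<open>v\<close>; coordinate \<open>j\<close> is thus
    filled in as in \<open>base_vol\<close>.\<close>
  have tot: "sum y (M - {m}) = ?c + sum y (avoiding M I S)"
  proof -
    have "M - {m} = meeting (M - {m}) I S \<union> avoiding M I S" "meeting (M - {m}) I S \<inter> avoiding M I S = {}"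
      using mA by (auto simp: meeting_def avoiding_def)
    then show ?thesis
      using finM sum.union_disjoint[of "meeting (M - {m}) I S" "avoiding M I S" y]
      by (simp add: cut_sum_def)
  qed
  have totA: "sum (y(m := v)) (meeting M I S) = ?c + v" for v
  proof -
    have "sum (y(m := v)) (meeting M I S) = cut_sum M I (y(m := v)) S" by (simp add: cut_sum_def)
    then show ?thesis using SE by (simp add: cut_sum_upd Int_commute)
  qed
  let ?f = "\<lambda>x. if 0 < gap y S x \<and> gap y S x \<le> Y \<and>
       base_polytope E M I (y(m := gap y S x)) (point y (gap y S x) x) then 1 else 0 :: ennreal"
  have gap_meas [measurable]: "gap y S \<in> borel_measurable (lebesgue_on_coords A)" if "S \<subseteq> A" for A
    unfolding gap_def using that by measurable
  have "Measurable.pred (lebesgue_on_coords (E - {j}))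
      (\<lambda>x. base_polytope E M I (y(m := gap y S x)) (point y (gap y S x) x))"
    by (intro base_polytope_point_measurable gap_meas SEj)
  then have f_meas: "?f \<in> borel_measurable (lebesgue_on_coords (E - {j}))"
    using gap_meas[OF SEj] by measurable
  have "Measurable.pred (lebesgue_on_coords S) (\<lambda>x. ?A (gap y S x) x)"
    by (intro base_polytope_measurable upd_measurable gap_meas finS) (auto simp: finM)
  then have G_meas: "?G \<in> borel_measurable (lebesgue_on_coords S)"
    by measurable
  have H: "base_vol (E - S) j (avoiding M I S) I y = (\<integral>\<^sup>+z. ?H z \<partial>lebesgue_on_coords ?T)"
    by (simp add: base_vol_def)
  have H_meas: "?H \<in> borel_measurable (lebesgue_on_coords ?T)"
  proof -
    have "finite (E - S)" "finite (avoiding M I S)" "j \<in> E - S" using finE finM jE SE by auto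
    from base_polytope_fill_measurable[OF this] show ?thesis by measurable
  qed
  have fGH: "?f (merge S ?T (x, z)) = ?G x * ?H z" for x z
  proof -
    let ?x = "merge S ?T (x, z)"
    have sums: "sum ?x S = sum x S" "sum ?x ?T = sum z ?T"
      by (rule sum.cong; auto simp: merge_def)+
    have sumE: "sum ?x (E - {j}) = sum x S + sum z ?T"
      using sum.union_disjoint[OF finS _ ST(2), of ?x] finE unfolding ST(1) by (simp add: sums)
    have g: "gap y S ?x = gap y S x" by (simp add: gap_def sums)
    have p: "point y (gap y S x) ?x = ?x(j := sum y (avoiding M I S) - sum z ?T)"
      by (simp add: point_def sumE gap_def tot)
    \<comment> \<open>This equality activates the facet lemma; positivity of \<open>v\<close>
      supplies the nonnegative weights it asks for.\<close>
    have "sum (point y v ?x) S = cut_sum M I (y(m := v)) S" if "v = gap y S x" for v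
      using that SE by (simp add: sum_point_cut[OF S] sums cut_sum_upd gap_def Int_commute)
    then have "base_polytope E M I (y(m := v)) (point y v ?x) \<longleftrightarrow>
        ?A v (point y v ?x) \<and> base_polytope (E - S) (avoiding M I S) I (y(m := v)) (point y v ?x)"
      if "v = gap y S x" "0 < v" for v
      using that y base_polytope_facet[OF finE finM SE(1), of "y(m := v)" I "point y v ?x"] by auto
    moreover have "?A v (point y v ?x) \<longleftrightarrow> ?A v x" for v
      using SE by (intro base_polytope_cong) (auto simp: point_def merge_def)
    moreover have "base_polytope (E - S) (avoiding M I S) I (y(m := v)) (point y v ?x) \<longleftrightarrow>
        ?B (z(j := sum y (avoiding M I S) - sum z ?T))" if "v = gap y S x" for v
      using mA unfolding that p by (intro base_polytope_cong) (auto simp: merge_def)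
    ultimately show ?thesis by (auto simp: g)
  qed
  have "(\<integral>\<^sup>+x. ?f x \<partial>lebesgue_on_coords (E - {j})) =
      (\<integral>\<^sup>+x. \<integral>\<^sup>+z. ?f (merge S ?T (x, z)) \<partial>lebesgue_on_coords ?T \<partial>lebesgue_on_coords S)"
    using lborel_prod.product_nn_integral_fold[of S ?T ?f] finS finE f_meas unfolding ST by simp
  also have "\<dots> = (\<integral>\<^sup>+x. ?G x \<partial>lebesgue_on_coords S) * base_vol (E - S) j (avoiding M I S) I y"
    unfolding fGH H using H_meas G_meas by (simp add: nn_integral_cmult nn_integral_multc)
  \<comment> \<open>With this constant \<open>?c\<close>, the slicing variable \<open>v\<close> is
    the gap itself.\<close>
  also have "(\<integral>\<^sup>+x. ?G x \<partial>lebesgue_on_coords S) =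
      (\<integral>\<^sup>+v. \<integral>\<^sup>+w. ?G (w(l := ?c + v - sum w (S - {l}))) \<partial>lebesgue_on_coords (S - {l}) \<partial>lborel)"
    by (rule nn_integral_coords_sum[OF finS l G_meas])
  also have "\<dots> = (\<integral>\<^sup>+v. indicator {0<..Y} v * base_vol S l (meeting M I S) (\<lambda>i. I i \<inter> S) (y(m := v)) \<partial>lborel)"
  proof (rule nn_integral_cong)
    fix v
    have g: "gap y S (w(l := ?c + v - sum w (S - {l}))) = v" for w
    proof -
      have "sum (w(l := ?c + v - sum w (S - {l}))) (S - {l}) = sum w (S - {l})"
        by (rule sum.cong) auto
      then show ?thesis using finS l by (simp add: gap_def sum.remove[of S l])
    qed
    show "(\<integral>\<^sup>+w. ?G (w(l := ?c + v - sum w (S - {l}))) \<partial>lebesgue_on_coords (S - {l})) =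
        indicator {0<..Y} v * base_vol S l (meeting M I S) (\<lambda>i. I i \<inter> S) (y(m := v))"
      unfolding g base_vol_def totA by (auto simp: indicator_def)
  qed
  finally show ?thesis .
qed

lemma base_vol_growth:
  assumes y: "\<And>i. i \<in> M \<Longrightarrow> y i \<ge> 0" and Y: "Y \<ge> 0" and l: "\<And>S. S \<in> cuts \<Longrightarrow> l S \<in> S"
  shows "base_vol E j M I (y(m := Y)) = base_vol E j (M - {m}) I y +
    (\<Sum>S\<in>cuts. (\<integral>\<^sup>+v. indicator {0<..Y} v *
        base_vol S (l S) (meeting M I S) (\<lambda>i. I i \<inter> S) (y(m := v)) \<partial>lborel) *
      base_vol (E - S) j (avoiding M I S) I y)"
proof -
  let ?L = "lebesgue_on_coords (E - {j})"
  let ?f = "\<lambda>S x. if 0 < gap y S x \<and> gap y S x \<le> Y \<and>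
       base_polytope E M I (y(m := gap y S x)) (point y (gap y S x) x) then 1 else 0 :: ennreal"
  have gap_meas [measurable]: "gap y S \<in> borel_measurable ?L" if "S \<in> cuts" for S
    unfolding gap_def using that by (intro borel_measurable_diff sum_coords_measurable) (auto simp: cuts_def)
  have f_meas: "?f S \<in> borel_measurable ?L" if S: "S \<in> cuts" for S
    using base_polytope_point_measurable[OF gap_meas[OF S]] gap_meas[OF S] by measurable
  have f0_meas: "(\<lambda>x. if base_polytope E (M - {m}) I y (point y 0 x) then 1 else 0 :: ennreal) \<in> borel_measurable ?L"
    unfolding point_def using base_polytope_fill_measurable[OF finE finite_Diff[OF finM] jE] by measurable
  have "AE x in ?L. \<forall>S\<in>cuts. \<forall>T\<in>cuts. S \<noteq> T \<longrightarrow> gap y S x \<noteq> gap y T x"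
  proof (intro AE_finite_allI finite_cuts)
    fix S T assume ST: "S \<in> cuts" "T \<in> cuts"
    show "AE x in ?L. S \<noteq> T \<longrightarrow> gap y S x \<noteq> gap y T x"
    proof (cases "S = T")
      case False
      then have "AE x in ?L. gap y S x \<noteq> gap y T x"
        unfolding gap_def using ST finE by (intro AE_sum_neq) (auto simp: cuts_def)
      then show ?thesis by eventually_elim simp
    qed simp
  qed
  then have "AE x in ?L. (if base_polytope E M I (y(m := Y)) (point y Y x) then 1 else 0 :: ennreal) =
    (if base_polytope E (M - {m}) I y (point y 0 x) then 1 else 0) + (\<Sum>S\<in>cuts. ?f S x)"
    by eventually_elim (intro base_polytope_layers Y, blast)
  then have "(\<integral>\<^sup>+x. (if base_polytope E M I (y(m := Y)) (point y Y x) then 1 else 0 :: ennreal) \<partial>?L) =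
      (\<integral>\<^sup>+x. (if base_polytope E (M - {m}) I y (point y 0 x) then 1 else 0) + (\<Sum>S\<in>cuts. ?f S x) \<partial>?L)"
    by (rule nn_integral_cong_AE)
  also have "\<dots> = (\<integral>\<^sup>+x. (if base_polytope E (M - {m}) I y (point y 0 x) then 1 else 0) \<partial>?L) +
      (\<Sum>S\<in>cuts. \<integral>\<^sup>+x. ?f S x \<partial>?L)"
    using f_meas f0_meas by (subst nn_integral_add) (auto intro!: nn_integral_sum)
  also have "(\<Sum>S\<in>cuts. \<integral>\<^sup>+x. ?f S x \<partial>?L) = (\<Sum>S\<in>cuts. (\<integral>\<^sup>+v. indicator {0<..Y} v *
        base_vol S (l S) (meeting M I S) (\<lambda>i. I i \<inter> S) (y(m := v)) \<partial>lborel) *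
      base_vol (E - S) j (avoiding M I S) I y)"
    using l y by (intro sum.cong base_vol_layer) auto
  finally show ?thesis
    unfolding base_vol_def[of E j M] base_vol_def[of E j "M - {m}"]
    by (simp only: point_def sum_upd_total add_0_right)
qed

end

section \<open>The volume of a base polytope\<close>

text \<open>All partial sums are at most 0 and the total is 0, so only the origin remains. It has
  measure zero unless dropping \<open>k\<close> leaves no coordinate at all.\<close>

lemma base_vol_no_summands:
  fixes E :: "'b set" and I :: "'a \<Rightarrow> 'b set"
  assumes fin: "finite E" and k: "k \<in> E"
  shows "base_vol E k {} I y = ennreal (drac_sum E {} I y)"
proof (cases "E = {k}")
  case True
  have "base_polytope E {} I y (x(k := 0))" for x
    unfolding base_polytope_def True by (auto simp: cut_sum_def meeting_def subset_singleton_iff)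
  then show ?thesis
    using True by (simp add: base_vol_def drac_sum_empty PiM_empty)
next
  case False
  then obtain l where l: "l \<in> E - {k}" using k by blast
  have card: "card E \<noteq> 1" using False k by (auto simp: card_1_singleton_iff)
  have "AE x in lebesgue_on_coords (E - {k}). sum x {l} - 0 \<noteq> sum x {} - 0"
    using fin l by (intro AE_sum_neq) auto
  then have "AE x in lebesgue_on_coords (E - {k}).
      (if base_polytope E {} I y (x(k := 0 - sum x (E - {k}))) then 1 else 0 :: ennreal) = 0"
  proof eventually_elim
    fix x :: "'b \<Rightarrow> real"
    assume x: "sum x {l} - 0 \<noteq> sum x {} - 0"
    let ?t = "x(k := 0 - sum x (E - {k}))"
    have "\<not> base_polytope E {} I y ?t"
    proof
      assume bp: "base_polytope E {} I y ?t"
      have "sum ?t W \<le> 0" if "W \<subseteq> E" for W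
        using bp that unfolding base_polytope_def by (simp add: cut_sum_def meeting_def del: fun_upd_apply)
      then have "sum ?t {l} \<le> 0" "sum ?t (E - {l}) \<le> 0"
        using l by blast+
      moreover have "sum ?t E = 0" using bp by (simp add: base_polytope_def del: fun_upd_apply)
      moreover have "sum ?t E = ?t l + sum ?t (E - {l})"
        using fin l by (intro sum.remove) auto
      ultimately show False using x l by simp
    qed
    then show "(if base_polytope E {} I y ?t then 1 else 0 :: ennreal) = 0" by simp
  qed
  then have "base_vol E k {} I y = (\<integral>\<^sup>+x. 0 \<partial>lebesgue_on_coords (E - {k}))"
    unfolding base_vol_def sum.empty by (rule nn_integral_cong_AE)
  then show ?thesis using card by (simp add: drac_sum_empty)
qed

lemma drac_sum_upd_measurable:
  "(\<lambda>v. drac_sum E M I (y(m := v))) \<in> borel_measurable borel"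
proof -
  have "(\<lambda>v. (y(m := v)) i) \<in> borel_measurable borel" for i
    by (cases "i = m") auto
  then show ?thesis
    unfolding drac_sum_def monom_val_def
    by (intro borel_measurable_sum borel_measurable_prod borel_measurable_divide borel_measurable_power) auto
qed

lemma (in drac_step) drac_sum_growth:
  assumes y: "\<And>i. i \<in> M \<Longrightarrow> y i \<ge> 0" and Y: "Y \<ge> 0"
  shows "ennreal (drac_sum E M I (y(m := Y))) = ennreal (drac_sum E (M - {m}) I y) +
    (\<Sum>S\<in>cuts. (\<integral>\<^sup>+v. indicator {0<..Y} v *
        ennreal (drac_sum S (meeting M I S) (\<lambda>i. I i \<inter> S) (y(m := v))) \<partial>lborel) *
      ennreal (drac_sum (E - S) (avoiding M I S) I y))"
proof -
  let ?D = "\<lambda>S v. drac_sum S (meeting M I S) (\<lambda>i. I i \<inter> S) (y(m := v))"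
  let ?C = "\<lambda>S. drac_sum (E - S) (avoiding M I S) I y"
  let ?f = "\<lambda>v. \<Sum>S\<in>cuts. ?D S v * ?C S"
  note [measurable] = drac_sum_upd_measurable
  have C: "?C S \<ge> 0" for S
    using y by (intro drac_sum_nonneg) (auto simp: avoiding_def)
  have D: "?D S v \<ge> 0" if "v \<ge> 0" for S v
    using y that by (intro drac_sum_nonneg) (auto simp: meeting_def)
  have zero: "drac_sum E M I (y(m := 0)) = drac_sum E (M - {m}) I y"
    using drac_sum_insert_zero[of "M - {m}" m E I y] finM mM by (simp add: insert_absorb)
  have DC: "?D S v * ?C S \<ge> 0" if "v \<ge> 0" for S v
    using C D[OF that] by simp
  have "(\<integral>\<^sup>+v. ennreal (?f v) * indicator {0..Y} v \<partial>lborel) =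
      ennreal (drac_sum E M I (y(m := Y)) - drac_sum E (M - {m}) I y)"
    unfolding zero[symmetric]
    by (rule nn_integral_FTC_Icc) (auto intro!: drac_sum_deriv sum_nonneg DC Y simp del: fun_upd_apply)
  also have "(\<integral>\<^sup>+v. ennreal (?f v) * indicator {0..Y} v \<partial>lborel) =
      (\<integral>\<^sup>+v. (\<Sum>S\<in>cuts. indicator {0<..Y} v * ennreal (?D S v) * ennreal (?C S)) \<partial>lborel)"
  proof (rule nn_integral_cong_AE)
    \<comment> \<open>The fundamental theorem uses the closed interval and the layers the half-open
      one; they differ at 0 only.\<close>
    have "AE v in lborel. v \<noteq> (0::real)" by (rule AE_lborel_singleton)
    then show "AE v in lborel. ennreal (?f v) * indicator {0..Y} v =
        (\<Sum>S\<in>cuts. indicator {0<..Y} v * ennreal (?D S v) * ennreal (?C S))"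
    proof eventually_elim
      fix v :: real assume v: "v \<noteq> 0"
      show "ennreal (?f v) * indicator {0..Y} v =
        (\<Sum>S\<in>cuts. indicator {0<..Y} v * ennreal (?D S v) * ennreal (?C S))"
      proof (cases "0 < v \<and> v \<le> Y")
        case True
        then have "ennreal (?f v) = (\<Sum>S\<in>cuts. ennreal (?D S v * ?C S))"
          by (intro sum_ennreal[symmetric] DC) auto
        then show ?thesis
          using True C D by (simp add: ennreal_mult del: fun_upd_apply)
      qed (use v in auto)
    qed
  qed
  also have "\<dots> = (\<Sum>S\<in>cuts. (\<integral>\<^sup>+v. indicator {0<..Y} v * ennreal (?D S v) \<partial>lborel) * ennreal (?C S))"
    by (subst nn_integral_sum) (auto simp: nn_integral_multc simp del: fun_upd_apply)
  finally have eq: "(\<Sum>S\<in>cuts. (\<integral>\<^sup>+v. indicator {0<..Y} v * ennreal (?D S v) \<partial>lborel) * ennreal (?C S)) =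
    ennreal (drac_sum E M I (y(m := Y)) - drac_sum E (M - {m}) I y)" .
  \<comment> \<open>Since \<open>ennreal\<close> truncates negative numbers, the difference can be
    added back only after monotonicity is known.\<close>
  have "drac_sum E M I (y(m := 0)) \<le> drac_sum E M I (y(m := Y))"
  proof (rule DERIV_nonneg_imp_nondecreasing[OF Y])
    fix v assume "0 \<le> v" "v \<le> Y"
    then have "?f v \<ge> 0" by (intro sum_nonneg DC)
    then show "\<exists>d. ((\<lambda>v. drac_sum E M I (y(m := v))) has_real_derivative d) (at v) \<and> 0 \<le> d"
      using drac_sum_deriv by blast
  qed
  then have "ennreal (drac_sum E M I (y(m := Y))) = ennreal (drac_sum E (M - {m}) I y) +
      ennreal (drac_sum E M I (y(m := Y)) - drac_sum E (M - {m}) I y)"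
    using y by (subst ennreal_plus[symmetric]) (auto simp: zero intro!: drac_sum_nonneg)
  then show ?thesis unfolding eq .
qed

text \<open>The outer induction on \<open>card E\<close> handles both factors of a face, as
  \<open>S\<close> is nonempty and \<open>E - S\<close> contains \<open>j\<close>; \<open>I\<close>
  and \<open>y\<close> must vary for the traces and for the running value of \<open>y m\<close>. The
  inner induction on \<open>M\<close> handles the initial value.\<close>

lemma base_vol_eq_drac_sum:
  fixes E :: "'b set" and M :: "'a set"
  assumes "finite E" "finite M" "k \<in> E"
    and "\<And>i. i \<in> M \<Longrightarrow> I i \<subseteq> E" "\<And>i. i \<in> M \<Longrightarrow> I i \<noteq> {}" "\<And>i. i \<in> M \<Longrightarrow> y i \<ge> 0"
  shows "base_vol E k M I y = ennreal (drac_sum E M I y)"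
  using assms
proof (induction "card E" arbitrary: E M I k y rule: less_induct)
  case less
  note finE = \<open>finite E\<close>
  show ?case
    using less.prems(2-)
  proof (induction M arbitrary: k rule: finite_induct)
    case empty
    show ?case using finE empty.prems(1) by (rule base_vol_no_summands)
  next
    case (insert m M)
    let ?M = "insert m M"
    have "I m \<noteq> {}" using insert.prems by simp
    then obtain j where j: "j \<in> I m" by blast
    interpret drac_step E ?M I m j
      using finE insert j by unfold_locales auto
    have M: "?M - {m} = M" using insert.hyps by simp
    obtain l where l: "\<And>S. S \<in> cuts \<Longrightarrow> l S \<in> S"
    proof -
      have "\<forall>S\<in>cuts. \<exists>l. l \<in> S" by (auto simp: cuts_def)
      then show thesis using that by metis
    qed
    have S: "S \<subseteq> E" "card S < card E" "card (E - S) < card E" "finite S" "j \<in> E - S" if "S \<in> cuts" for S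
    proof -
      have "S \<subset> E" "E - S \<subset> E" "j \<in> E - S" using that jE by (auto simp: cuts_def)
      then show "S \<subseteq> E" "card S < card E" "card (E - S) < card E" "finite S" "j \<in> E - S"
        using finE by (auto intro: psubset_card_mono finite_subset)
    qed
    have A: "base_vol S (l S) (meeting ?M I S) (\<lambda>i. I i \<inter> S) (y(m := v)) =
        ennreal (drac_sum S (meeting ?M I S) (\<lambda>i. I i \<inter> S) (y(m := v)))" if "S \<in> cuts" "v \<ge> 0" for S v
      using that S[OF that(1)] l finM insert.prems(4)
      by (intro less.hyps) (auto simp: meeting_def)
    have B: "base_vol (E - S) j (avoiding ?M I S) I y =
        ennreal (drac_sum (E - S) (avoiding ?M I S) I y)" if "S \<in> cuts" for S
    proof (rule less.hyps)
      show "I i \<subseteq> E - S" if "i \<in> avoiding ?M I S" for i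
        using that sub[of i] by (auto simp: avoiding_def)
    qed (use S[OF that] finM finE insert.prems in \<open>auto simp: avoiding_def\<close>)
    have "base_vol E k ?M I y = base_vol E j ?M I (y(m := y m))"
      using base_vol_indep[OF finE finM insert.prems(1) jE] by simp
    also have "\<dots> = ennreal (drac_sum E M I y) +
      (\<Sum>S\<in>cuts. (\<integral>\<^sup>+v. indicator {0<..y m} v *
          ennreal (drac_sum S (meeting ?M I S) (\<lambda>i. I i \<inter> S) (y(m := v))) \<partial>lborel) *
        ennreal (drac_sum (E - S) (avoiding ?M I S) I y))"
    proof -
      have "base_vol E j M I y = ennreal (drac_sum E M I y)"
        using insert.prems jE by (intro insert.IH) auto
      moreover have "(\<integral>\<^sup>+v. indicator {0<..y m} v *
          base_vol S (l S) (meeting ?M I S) (\<lambda>i. I i \<inter> S) (y(m := v)) \<partial>lborel) =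
        (\<integral>\<^sup>+v. indicator {0<..y m} v *
          ennreal (drac_sum S (meeting ?M I S) (\<lambda>i. I i \<inter> S) (y(m := v))) \<partial>lborel)" if "S \<in> cuts" for S
        using A[OF that] by (intro nn_integral_cong) (auto simp: indicator_def)
      moreover have "y m \<ge> 0" using insert.prems by simp
      ultimately show ?thesis
        using base_vol_growth[of y "y m" l] l insert.prems(4) B unfolding M by simp
    qed
    also have "\<dots> = ennreal (drac_sum E ?M I (y(m := y m)))"
      using drac_sum_growth[of y "y m"] insert.prems(4) unfolding M by simp
    finally show ?case by simp
  qed
qed

section \<open>Minkowski sums of simplices as base polytopes\<close>

text \<open>Row \<open>i\<close> is a point of the \<open>i\<close>-th scaled simplex; the column
  sums are the coordinates of the Minkowski sum.\<close>

definition flow :: "'b set \<Rightarrow> 'a set \<Rightarrow> ('a \<Rightarrow> 'b set) \<Rightarrow> ('a \<Rightarrow> real) \<Rightarrow> ('a \<times> 'b \<Rightarrow> real) \<Rightarrow> bool" where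
  "flow E M I y f \<longleftrightarrow> (\<forall>i\<in>M. (\<forall>j. f (i, j) \<ge> 0) \<and> (\<forall>j. j \<notin> I i \<longrightarrow> f (i, j) = 0) \<and> (\<Sum>j\<in>E. f (i, j)) = y i)"

lemma flow_le:
  assumes "finite E" "flow E M I y f" "i \<in> M" "j \<in> E"
  shows "f (i, j) \<le> y i"
  using assms member_le_sum[of j E "\<lambda>j. f (i, j)"] by (simp add: flow_def)

lemma flow_imp_base_polytope:
  assumes fin: "finite E" "finite M" and f: "flow E M I y f"
  shows "base_polytope E M I y (\<lambda>j. \<Sum>i\<in>M. f (i, j))"
proof -
  have swap: "(\<Sum>j\<in>W. \<Sum>i\<in>M. f (i, j)) = (\<Sum>i\<in>M. \<Sum>j\<in>W. f (i, j))" for W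
    by (rule sum.swap)
  have "(\<Sum>j\<in>W. \<Sum>i\<in>M. f (i, j)) \<le> cut_sum M I y W" if W: "W \<subseteq> E" for W
  proof -
    have "(\<Sum>i\<in>M. \<Sum>j\<in>W. f (i, j)) = (\<Sum>i\<in>meeting M I W. \<Sum>j\<in>W. f (i, j))"
      using fin f by (intro sum.mono_neutral_right) (auto simp: meeting_def flow_def intro!: sum.neutral)
    also have "\<dots> \<le> (\<Sum>i\<in>meeting M I W. y i)"
    proof (rule sum_mono)
      fix i assume i: "i \<in> meeting M I W"
      have "(\<Sum>j\<in>W. f (i, j)) \<le> (\<Sum>j\<in>E. f (i, j))"
        using fin W f i by (intro sum_mono2) (auto simp: meeting_def flow_def)
      then show "(\<Sum>j\<in>W. f (i, j)) \<le> y i" using f i by (simp add: meeting_def flow_def)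
    qed
    finally show ?thesis by (simp add: swap cut_sum_def)
  qed
  moreover have "(\<Sum>j\<in>E. \<Sum>i\<in>M. f (i, j)) = sum y M"
    unfolding swap using f by (intro sum.cong) (auto simp: flow_def)
  ultimately show ?thesis by (simp add: base_polytope_def)
qed

text \<open>The nontrivial half of the flow criterion is obtained by least squares: a minimizer
  exists by compactness and is later shown to have distance 0.\<close>

lemma exists_closest_flow:
  fixes t :: "'b \<Rightarrow> real"
  assumes fin: "finite E" "finite M" and sub: "\<And>i. i \<in> M \<Longrightarrow> I i \<subseteq> E"
    and ne: "\<And>i. i \<in> M \<Longrightarrow> I i \<noteq> {}" and y: "\<And>i. i \<in> M \<Longrightarrow> y i \<ge> 0"
  shows "\<exists>f. flow E M I y f \<and> (\<forall>g. flow E M I y g \<longrightarrow>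
      (\<Sum>j\<in>E. (t j - (\<Sum>i\<in>M. f (i, j)))\<^sup>2) \<le> (\<Sum>j\<in>E. (t j - (\<Sum>i\<in>M. g (i, j)))\<^sup>2))"
proof -
  \<comment> \<open>Pinning all entries off the edges to 0 makes this box a product of compact sets
    even over an infinite index type. Any flow can be cleared outside the rows of \<open>M\<close>
    without changing its distance to \<open>t\<close>.\<close>
  let ?B = "PiE UNIV (\<lambda>p. if fst p \<in> M \<and> snd p \<in> I (fst p) then {0..y (fst p)} else {0 :: real})"
  let ?K = "?B \<inter> (\<Inter>i\<in>M. {f. (\<Sum>j\<in>E. f (i, j)) = y i})"
  let ?q = "\<lambda>f. \<Sum>j\<in>E. (t j - (\<Sum>i\<in>M. f (i, j)))\<^sup>2"
  have coord: "continuous_on UNIV (\<lambda>f :: 'a \<times> 'b \<Rightarrow> real. f p)" for p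
    by simp
  have "compactin (product_topology (\<lambda>p. euclidean) UNIV) ?B"
    unfolding compactin_PiE by auto
  then have "compact ?B" by (simp add: euclidean_product_topology)
  moreover have "closed {f. (\<Sum>j\<in>E. f (i, j)) = y i}" for i
    by (intro closed_Collect_eq continuous_on_sum coord continuous_on_const)
  ultimately have compact: "compact ?K" by (intro compact_Int_closed closed_INT) auto
  have flowK: "flow E M I y f" if "f \<in> ?K" for f
    using that by (fastforce simp: flow_def PiE_iff split: if_splits)
  have restr: "(\<lambda>p. if fst p \<in> M then g p else 0) \<in> ?K" if g: "flow E M I y g" for g
  proof -
    have "0 \<le> g (i, j) \<and> g (i, j) \<le> y i" if "i \<in> M" "j \<in> I i" for i j
      using that sub flow_le[OF fin(1) g, of i j] g by (auto simp: flow_def)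
    then show ?thesis using g by (auto simp: PiE_iff flow_def)
  qed
  obtain s where s: "\<And>i. i \<in> M \<Longrightarrow> s i \<in> I i"
  proof -
    have "\<forall>i\<in>M. \<exists>j. j \<in> I i" using ne by blast
    then show thesis using that by metis
  qed
  have start: "flow E M I y (\<lambda>(i, j). if j = s i then y i else 0)"
    using s sub y fin by (force simp: flow_def)
  have "?K \<noteq> {}"
  proof
    assume "?K = {}"
    with restr[OF start] show False by (simp only: empty_iff)
  qed
  moreover have "continuous_on UNIV ?q"
    by (intro continuous_on_sum continuous_on_power continuous_on_diff continuous_on_const coord)
  then have "continuous_on ?K ?q" by (rule continuous_on_subset) simp
  ultimately have "\<exists>f\<in>?K. \<forall>g\<in>?K. ?q f \<le> ?q g"
    by (intro continuous_attains_inf[OF compact])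
  then obtain f where f: "f \<in> ?K" "\<forall>g\<in>?K. ?q f \<le> ?q g"
    by (rule bexE)
  show ?thesis
  proof (intro exI conjI allI impI)
    show "flow E M I y f" by (rule flowK[OF f(1)])
    show "?q f \<le> ?q g" if "flow E M I y g" for g
    proof -
      have "?q f \<le> ?q (\<lambda>p. if fst p \<in> M then g p else 0)" by (rule bspec[OF f(2) restr[OF that]])
      then show ?thesis by simp
    qed
  qed
qed

text \<open>
  For a flow that comes closest to \<open>t\<close>, all mass sent out by \<open>i\<close> sits where the deficit
  \<open>c j = t j - (\<Sum>i. f (i, j))\<close> is largest on \<open>I i\<close>, since otherwise shifting mass would
  reduce the distance.  A positive maximal deficit would then violate the inequality of its level set.
\<close>

lemma base_polytope_imp_flow:
  fixes t :: "'b \<Rightarrow> real"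
  assumes fin: "finite E" "finite M" and sub: "\<And>i. i \<in> M \<Longrightarrow> I i \<subseteq> E"
    and ne: "\<And>i. i \<in> M \<Longrightarrow> I i \<noteq> {}" and y: "\<And>i. i \<in> M \<Longrightarrow> y i \<ge> 0"
    and t: "base_polytope E M I y t"
  shows "\<exists>f. flow E M I y f \<and> (\<forall>j\<in>E. (\<Sum>i\<in>M. f (i, j)) = t j)"
proof -
  obtain f where f: "flow E M I y f"
    and best: "\<And>g. flow E M I y g \<Longrightarrow>
      (\<Sum>j\<in>E. (t j - (\<Sum>i\<in>M. f (i, j)))\<^sup>2) \<le> (\<Sum>j\<in>E. (t j - (\<Sum>i\<in>M. g (i, j)))\<^sup>2)"
  proof -
    have "\<exists>f. flow E M I y f \<and> (\<forall>g. flow E M I y g \<longrightarrow>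
        (\<Sum>j\<in>E. (t j - (\<Sum>i\<in>M. f (i, j)))\<^sup>2) \<le> (\<Sum>j\<in>E. (t j - (\<Sum>i\<in>M. g (i, j)))\<^sup>2))"
      by (intro exists_closest_flow fin sub ne y)
    then show thesis using that by blast
  qed
  define c where "c j = t j - (\<Sum>i\<in>M. f (i, j))" for j
  have shift: "c k \<le> c j" if i: "i \<in> M" and fj: "f (i, j) > 0" and k: "k \<in> I i" for i j k
  proof (rule ccontr)
    assume "\<not> c k \<le> c j"
    then have less: "c j < c k" by simp
    then have jk: "j \<noteq> k" by auto
    have jE: "j \<in> E" "j \<in> I i" and kE: "k \<in> E"
      using f i fj k sub by (force simp: flow_def)+
    \<comment> \<open>The squared distance will change by \<open>2 * d * (d - (c k - c j))\<close>.
      Half of the difference makes this negative, and the other bound keeps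
      \<open>f (i, j) - d\<close> nonnegative.\<close>
    define d where "d = min (f (i, j)) ((c k - c j) / 2)"
    have d: "0 < d" "d \<le> f (i, j)" "d < c k - c j"
      using less fj by (auto simp: d_def min_less_iff_disj)
    define g where "g = f((i, j) := f (i, j) - d, (i, k) := f (i, k) + d)"
    have g_sum: "(\<Sum>l\<in>E. g (i, l)) = (\<Sum>l\<in>E. f (i, l))"
    proof -
      have "(\<Sum>l\<in>E. g (i, l)) = (\<Sum>l\<in>E. f (i, l) + ((if l = k then d else 0) - (if l = j then d else 0)))"
        using jk by (intro sum.cong) (auto simp: g_def)
      then show ?thesis using fin jE kE by (simp add: sum.distrib sum_subtractf)
    qed
    have "flow E M I y g"
      unfolding flow_def
    proof (intro ballI conjI allI impI)
      fix i' l assume i': "i' \<in> M"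
      show "0 \<le> g (i', l)"
        using f i' d unfolding g_def flow_def by (auto simp: add_nonneg_nonneg)
      show "g (i', l) = 0" if "l \<notin> I i'"
        using f i' that jE k by (auto simp: g_def flow_def)
    next
      fix i' assume i': "i' \<in> M"
      show "(\<Sum>l\<in>E. g (i', l)) = y i'"
      proof (cases "i' = i")
        case False
        then have "(\<Sum>l\<in>E. g (i', l)) = (\<Sum>l\<in>E. f (i', l))"
          by (intro sum.cong) (auto simp: g_def)
        then show ?thesis using f i' by (simp add: flow_def)
      qed (use g_sum f i in \<open>simp add: flow_def\<close>)
    qed
    note best[OF this]
    also have "(\<Sum>l\<in>E. (t l - (\<Sum>i\<in>M. g (i, l)))\<^sup>2) = (\<Sum>l\<in>E. (c l + (if l = j then d else 0) - (if l = k then d else 0))\<^sup>2)"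
    proof (rule sum.cong)
      fix l
      have "(\<Sum>i\<in>M. g (i, l)) = (\<Sum>i'\<in>M. f (i', l) + (if i' = i then (if l = k then d else 0) - (if l = j then d else 0) else 0))"
        using jk by (intro sum.cong) (auto simp: g_def)
      also have "\<dots> = (\<Sum>i'\<in>M. f (i', l)) + ((if l = k then d else 0) - (if l = j then d else 0))"
        using fin i by (simp add: sum.distrib)
      finally have "t l - (\<Sum>i\<in>M. g (i, l)) = c l + (if l = j then d else 0) - (if l = k then d else 0)"
        by (simp add: c_def)
      then show "(t l - (\<Sum>i\<in>M. g (i, l)))\<^sup>2 = (c l + (if l = j then d else 0) - (if l = k then d else 0))\<^sup>2"
        by (simp only:)
    qed simp
    also have "\<dots> = (\<Sum>l\<in>E. (c l)\<^sup>2 + ((if l = j then 2 * d * c j + d\<^sup>2 else 0) + (if l = k then d\<^sup>2 - 2 * d * c k else 0)))"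
      using jk by (intro sum.cong) (auto simp: power2_eq_square algebra_simps)
    also have "\<dots> = (\<Sum>l\<in>E. (c l)\<^sup>2) + (2 * d * c j + d\<^sup>2 + (d\<^sup>2 - 2 * d * c k))"
      using fin jE kE by (simp add: sum.distrib)
    also have "2 * d * c j + d\<^sup>2 + (d\<^sup>2 - 2 * d * c k) = 2 * (d * (d - (c k - c j)))"
      by (simp add: power2_eq_square algebra_simps)
    finally have "d * (d - (c k - c j)) \<ge> 0" by (simp add: c_def)
    then show False using d by (simp add: zero_le_mult_iff)
  qed
  have sum_c: "sum c E = 0"
  proof -
    have "base_polytope E M I y (\<lambda>j. \<Sum>i\<in>M. f (i, j))" by (rule flow_imp_base_polytope[OF fin f])
    then show ?thesis using t by (simp add: base_polytope_def c_def sum_subtractf)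
  qed
  have le: "c j \<le> 0" if "j \<in> E" for j
  proof (rule ccontr)
    assume "\<not> c j \<le> 0"
    define \<mu> where "\<mu> = Max (c ` E)"
    have \<mu>: "\<mu> \<ge> c j" "\<mu> \<in> c ` E" "\<And>k. k \<in> E \<Longrightarrow> c k \<le> \<mu>"
      using fin that unfolding \<mu>_def by (auto intro!: Max_in)
    define S where "S = {k \<in> E. c k = \<mu>}"
    have S: "S \<subseteq> E" "S \<noteq> {}" "finite S" using \<mu>(2) fin by (auto simp: S_def)
    have full: "(\<Sum>k\<in>S. f (i, k)) = y i" if i: "i \<in> meeting M I S" for i
    proof -
      obtain k where k: "k \<in> I i" "c k = \<mu>" "i \<in> M" using i by (auto simp: meeting_def S_def)
      have "f (i, l) = 0" if "l \<in> E - S" for l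
      proof (rule ccontr)
        assume "f (i, l) \<noteq> 0"
        then have "f (i, l) > 0" using f k by (force simp: flow_def less_le)
        then have "\<mu> \<le> c l" using shift k by blast
        then show False using \<mu>(3)[of l] that by (auto simp: S_def)
      qed
      then have "(\<Sum>l\<in>S. f (i, l)) = (\<Sum>l\<in>E. f (i, l))"
        using fin S by (intro sum.mono_neutral_left) auto
      then show ?thesis using f k by (simp add: flow_def)
    qed
    have "sum t S \<le> (\<Sum>i\<in>meeting M I S. y i)"
      using t S by (simp add: base_polytope_def cut_sum_def)
    also have "\<dots> = (\<Sum>i\<in>meeting M I S. \<Sum>k\<in>S. f (i, k))"
      by (simp add: full)
    also have "\<dots> \<le> (\<Sum>i\<in>M. \<Sum>k\<in>S. f (i, k))"
      using fin f by (intro sum_mono2) (auto simp: meeting_def flow_def intro!: sum_nonneg)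
    also have "\<dots> = (\<Sum>k\<in>S. \<Sum>i\<in>M. f (i, k))" by (rule sum.swap)
    finally have "sum c S \<le> 0" by (simp add: c_def sum_subtractf)
    moreover have "sum c S = card S * \<mu>" by (simp add: S_def)
    ultimately show False
      using S \<mu>(1) \<open>\<not> c j \<le> 0\<close> by (simp add: mult_le_0_iff)
  qed
  \<comment> \<open>Nonnegative terms with sum 0 all vanish, so the closest flow hits
    \<open>t\<close> exactly.\<close>
  have "sum (\<lambda>j. - c j) E = 0" using sum_c by (simp add: sum_negf)
  then have "\<forall>j\<in>E. - c j = 0" using fin le by (subst (asm) sum_nonneg_eq_0_iff) auto
  then have "(\<Sum>i\<in>M. f (i, j)) = t j" if "j \<in> E" for j
    using that unfolding c_def by fastforce
  with f show ?thesis by (intro exI[of _ f] conjI ballI)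
qed

section \<open>The generalized permutohedron and its projection\<close>

lemma sum_fun_apply: "(\<Sum>i\<in>A. f i) x = (\<Sum>i\<in>A. f i x)"
  by (induction A rule: infinite_finite_induct) auto

lemma coord_simplex_eq:
  assumes fin: "finite I"
  shows "coord_simplex I = {t. (\<forall>j. t j \<ge> 0) \<and> (\<forall>j. j \<notin> I \<longrightarrow> t j = 0) \<and> sum t I = 1}" (is "_ = ?T")
proof
  have "convex ?T"
    unfolding convex_def
    by (auto simp: scaleR_fun_def sum.distrib sum_distrib_left[symmetric])
  moreover have "coord_vec ` I \<subseteq> ?T"
    using fin by (auto simp: coord_vec_def)
  ultimately show "coord_simplex I \<subseteq> ?T"
    unfolding coord_simplex_def by (rule hull_minimal[rotated])
  show "?T \<subseteq> coord_simplex I"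
  proof
    fix t assume t: "t \<in> ?T"
    have "t = (\<Sum>j\<in>I. t j *\<^sub>R coord_vec j)"
      using t fin by (auto simp: fun_eq_iff sum_fun_apply scaleR_fun_def coord_vec_def if_distrib cong: if_cong)
    also have "\<dots> \<in> coord_simplex I"
      unfolding coord_simplex_def
      using t fin by (intro convex_sum) (auto intro: hull_inc)
    finally show "t \<in> coord_simplex I" .
  qed
qed

lemma gen_permutohedron_eq:
  assumes G: "bipartite_subgraph m n G" "no_isolated_vertices m n G"
    and y: "\<And>i. i \<in> {1..m} \<Longrightarrow> y i \<ge> 0"
  shows "gen_permutohedron m G y =
    {\<lambda>j. \<Sum>i\<in>{1..m}. f (i, j) | f. flow {1..n} {1..m} (nbrs G) y f}"
proof -
  have nb1: "nbrs G i \<subseteq> {1..n}" for i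
    using G by (auto simp: bipartite_subgraph_def nbrs_def)
  note nb = nb1 finite_subset[OF nb1 finite_atLeastAtMost]
  have nbn: "nbrs G i \<noteq> {}" if "i \<in> {1..m}" for i
    using G that by (auto simp: no_isolated_vertices_def nbrs_def)
  have P: "gen_permutohedron m G y =
      {sum s {1..m} | s. \<forall>i\<in>{1..m}. s i \<in> (\<lambda>t. y i *\<^sub>R t) ` coord_simplex (nbrs G i)}"
    unfolding gen_permutohedron_def by (rule set_sum_alt) simp
  have piece: "s \<in> (\<lambda>t. y i *\<^sub>R t) ` coord_simplex (nbrs G i) \<longleftrightarrow>
      (\<forall>j. s j \<ge> 0) \<and> (\<forall>j. j \<notin> nbrs G i \<longrightarrow> s j = 0) \<and> sum s {1..n} = y i" (is "?l \<longleftrightarrow> ?r")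
    if i: "i \<in> {1..m}" for i s
  proof -
    have sum_nb: "sum u {1..n} = sum u (nbrs G i)" if "\<forall>j. j \<notin> nbrs G i \<longrightarrow> u j = 0" for u :: "nat \<Rightarrow> real"
      using nb that by (intro sum.mono_neutral_right) auto
    show ?thesis
    proof
      assume ?l
      then obtain t where t: "t \<in> coord_simplex (nbrs G i)" "s = y i *\<^sub>R t" by blast
      then have tt: "\<forall>j. t j \<ge> 0" "\<forall>j. j \<notin> nbrs G i \<longrightarrow> t j = 0" "sum t (nbrs G i) = 1"
        by (auto simp: coord_simplex_eq[OF nb(2)])
      then show ?r
        using y[OF i] sum_nb[of s] t(2) by (auto simp: scaleR_fun_def sum_distrib_left[symmetric])
    next
      assume r: ?r
      then have s: "sum s (nbrs G i) = y i" using sum_nb[of s] by simp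
      show ?l
      \<comment> \<open>Division by \<open>y i\<close> recovers the point of the simplex only when
        \<open>y i\<close> is nonzero. Otherwise the piece is the origin, and any vertex serves as
        preimage because the neighbourhood is nonempty.\<close>
      proof (cases "y i = 0")
        case True
        then have "s j = 0" for j
          using s r nb(2) sum_nonneg_eq_0_iff[of "nbrs G i" s] by (cases "j \<in> nbrs G i") auto
        moreover obtain j where "j \<in> nbrs G i" using nbn[OF i] by blast
        then have "coord_vec j \<in> coord_simplex (nbrs G i)"
          unfolding coord_simplex_def by (intro hull_inc) auto
        ultimately show ?thesis
          using True by (intro image_eqI[of _ _ "coord_vec j"]) (auto simp: scaleR_fun_def fun_eq_iff)
      next
        case False
        then have "(\<lambda>j. s j / y i) \<in> coord_simplex (nbrs G i)"
          using r s y[OF i] by (auto simp: coord_simplex_eq[OF nb(2)] sum_divide_distrib[symmetric])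
        then show ?thesis
          using False by (intro image_eqI[of _ _ "\<lambda>j. s j / y i"]) (auto simp: scaleR_fun_def fun_eq_iff)
      qed
    qed
  qed
  show ?thesis
  proof (intro set_eqI iffI)
    fix t assume "t \<in> gen_permutohedron m G y"
    then obtain s where s: "t = sum s {1..m}"
      "\<And>i. i \<in> {1..m} \<Longrightarrow> s i \<in> (\<lambda>t. y i *\<^sub>R t) ` coord_simplex (nbrs G i)"
      unfolding P by blast
    have "flow {1..n} {1..m} (nbrs G) y (\<lambda>(i, j). s i j)"
      unfolding flow_def using s(2) piece by simp
    moreover have "t = (\<lambda>j. \<Sum>i\<in>{1..m}. (\<lambda>(i, j). s i j) (i, j))"
      by (auto simp: s(1) sum_fun_apply)
    ultimately show "t \<in> {\<lambda>j. \<Sum>i\<in>{1..m}. f (i, j) | f. flow {1..n} {1..m} (nbrs G) y f}"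
      by blast
  next
    fix t assume "t \<in> {\<lambda>j. \<Sum>i\<in>{1..m}. f (i, j) | f. flow {1..n} {1..m} (nbrs G) y f}"
    then obtain f where f: "t = (\<lambda>j. \<Sum>i\<in>{1..m}. f (i, j))" "flow {1..n} {1..m} (nbrs G) y f" by blast
    have "t = sum (\<lambda>i j. f (i, j)) {1..m}" by (auto simp: f(1) sum_fun_apply)
    moreover have "(\<lambda>j. f (i, j)) \<in> (\<lambda>t. y i *\<^sub>R t) ` coord_simplex (nbrs G i)" if "i \<in> {1..m}" for i
      using f(2) that piece[OF that] by (simp add: flow_def)
    ultimately show "t \<in> gen_permutohedron m G y"
      unfolding P by blast
  qed
qed

text \<open>The total determines coordinate \<open>n\<close>, so the projection loses nothing, and
  the image becomes a set given by finitely many linear conditions, hence measurable.\<close>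

lemma proj_gen_permutohedron:
  assumes n: "n \<ge> 1" and G: "bipartite_subgraph m n G" "no_isolated_vertices m n G"
    and y: "\<And>i. i \<in> {1..m} \<Longrightarrow> y i \<ge> 0"
  shows "(\<lambda>t. restrict t {1..<n}) ` gen_permutohedron m G y =
    {x \<in> space (lebesgue_on_coords {1..<n}).
      base_polytope {1..n} {1..m} (nbrs G) y (x(n := sum y {1..m} - sum x {1..<n}))}"
proof -
  have nb: "nbrs G i \<subseteq> {1..n}" for i
    using G by (auto simp: bipartite_subgraph_def nbrs_def)
  have nbn: "nbrs G i \<noteq> {}" if "i \<in> {1..m}" for i
    using G that by (auto simp: no_isolated_vertices_def nbrs_def)
  have E: "{1..n} = insert n {1..<n}" using n by auto
  have P: "gen_permutohedron m G y =
      {\<lambda>j. \<Sum>i\<in>{1..m}. f (i, j) | f. flow {1..n} {1..m} (nbrs G) y f}"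
    by (intro gen_permutohedron_eq G y)
  show ?thesis
  proof (intro set_eqI iffI)
    fix x assume "x \<in> (\<lambda>t. restrict t {1..<n}) ` gen_permutohedron m G y"
    then obtain f where f: "flow {1..n} {1..m} (nbrs G) y f"
      and x: "x = restrict (\<lambda>j. \<Sum>i\<in>{1..m}. f (i, j)) {1..<n}"
      unfolding P by blast
    let ?t = "\<lambda>j. \<Sum>i\<in>{1..m}. f (i, j)"
    have bp: "base_polytope {1..n} {1..m} (nbrs G) y ?t"
      using f by (intro flow_imp_base_polytope) auto
    then have "?t n + sum ?t {1..<n} = sum y {1..m}"
      unfolding base_polytope_def E by simp
    then have "(x(n := sum y {1..m} - sum x {1..<n})) j = ?t j" if "j \<in> {1..n}" for j
      using that by (auto simp: x)
    then have "base_polytope {1..n} {1..m} (nbrs G) y (x(n := sum y {1..m} - sum x {1..<n}))"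
      using bp base_polytope_cong[of "{1..n}" _ ?t "{1..m}" y y] by blast
    then show "x \<in> {x \<in> space (lebesgue_on_coords {1..<n}).
      base_polytope {1..n} {1..m} (nbrs G) y (x(n := sum y {1..m} - sum x {1..<n}))}"
      by (simp add: x space_PiM)
  next
    fix x assume x: "x \<in> {x \<in> space (lebesgue_on_coords {1..<n}).
      base_polytope {1..n} {1..m} (nbrs G) y (x(n := sum y {1..m} - sum x {1..<n}))}"
    let ?t = "x(n := sum y {1..m} - sum x {1..<n})"
    have "\<exists>f. flow {1..n} {1..m} (nbrs G) y f \<and> (\<forall>j\<in>{1..n}. (\<Sum>i\<in>{1..m}. f (i, j)) = ?t j)"
      using x by (intro base_polytope_imp_flow nb nbn y) (auto simp del: fun_upd_apply)
    then obtain f where f: "flow {1..n} {1..m} (nbrs G) y f"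
      "\<And>j. j \<in> {1..n} \<Longrightarrow> (\<Sum>i\<in>{1..m}. f (i, j)) = ?t j"
      by blast
    have "x = restrict (\<lambda>j. \<Sum>i\<in>{1..m}. f (i, j)) {1..<n}"
      using x f(2) by (auto simp: space_PiM fun_eq_iff PiE_iff extensional_def)
    moreover have "(\<lambda>j. \<Sum>i\<in>{1..m}. f (i, j)) \<in> gen_permutohedron m G y"
      unfolding P using f(1) by blast
    ultimately show "x \<in> (\<lambda>t. restrict t {1..<n}) ` gen_permutohedron m G y"
      by (rule image_eqI)
  qed
qed

text \<open>For given \<open>W\<close> the relevant index set is that of all \<open>i\<close> with
  \<open>nbrs G i \<subseteq> W\<close>; for given \<open>J\<close> the relevant \<open>W\<close> is
  the union of its neighbourhoods. Each choice gives the stronger inequality.\<close>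

lemma draconian_iff:
  assumes G: "bipartite_subgraph m n G" "no_isolated_vertices m n G" and n: "n \<ge> 1"
  shows "draconian m n G a \<longleftrightarrow> a \<in> drac_seqs {1..n} {1..m} (nbrs G)"
proof -
  have nb: "nbrs G i \<subseteq> {1..n}" for i
    using G by (auto simp: bipartite_subgraph_def nbrs_def)
  have nbn: "nbrs G i \<noteq> {}" if "i \<in> {1..m}" for i
    using G that by (auto simp: no_isolated_vertices_def nbrs_def)
  have "(\<forall>J. J \<subseteq> {1..m} \<and> J \<noteq> {} \<longrightarrow> card (\<Union>i\<in>J. nbrs G i) \<ge> sum a J + 1) \<longleftrightarrow>
      (\<forall>W\<subseteq>{1..n}. W \<noteq> {} \<longrightarrow> (\<Sum>i | i \<in> {1..m} \<and> nbrs G i \<subseteq> W. a i) < card W)" (is "?l \<longleftrightarrow> ?r")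
  proof
    assume l: ?l
    show ?r
    proof (intro allI impI)
      fix W assume W: "W \<subseteq> {1..n}" "W \<noteq> {}"
      let ?J = "{i. i \<in> {1..m} \<and> nbrs G i \<subseteq> W}"
      have fW: "finite W" using W finite_subset by blast
      show "sum a ?J < card W"
      proof (cases "?J = {}")
        case True
        then show ?thesis using W fW by (simp only: sum.empty) (simp add: card_gt_0_iff)
      next
        case False
        have "?J \<subseteq> {1..m}" by blast
        then have "sum a ?J + 1 \<le> card (\<Union>i\<in>?J. nbrs G i)" using l False by blast
        also have "\<dots> \<le> card W" using fW by (intro card_mono) auto
        finally show ?thesis by simp
      qed
    qed
  next
    assume r: ?r
    show ?l
    proof (intro allI impI, elim conjE)
      fix J assume J: "J \<subseteq> {1..m}" "J \<noteq> {}"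
      let ?W = "\<Union>i\<in>J. nbrs G i"
      have "sum a J \<le> (\<Sum>i | i \<in> {1..m} \<and> nbrs G i \<subseteq> ?W. a i)"
        using J by (intro sum_mono2) auto
      also have "\<dots> < card ?W"
      proof -
        obtain i where "i \<in> J" "i \<in> {1..m}" using J by blast
        then have "?W \<noteq> {}" using nbn[of i] by auto
        moreover have "?W \<subseteq> {1..n}" using nb by (rule UN_least)
        ultimately show ?thesis by (intro r[rule_format])
      qed
      finally show "sum a J + 1 \<le> card ?W" by simp
    qed
  qed
  moreover have "sum a {1..m} = n - 1 \<longleftrightarrow> sum a {1..m} + 1 = card {1..n}" using n by auto
  ultimately show ?thesis
    unfolding draconian_def drac_seqs_def drac_def by blast
qed

theorem theorem9p3:
  fixes m n :: nat and G :: "(nat \<times> nat) set" and y :: "nat \<Rightarrow> real"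
  assumes "m \<ge> 1" and "n \<ge> 1"
    and "bipartite_subgraph m n G"
    and "no_isolated_vertices m n G"
    and "\<And>i. i \<in> {1..m} \<Longrightarrow> y i \<ge> 0"
  shows "proj_vol n (gen_permutohedron m G y) =
    (\<Sum>a | draconian m n G a. \<Prod>i\<in>{1..m}. y i ^ a i / fact (a i))"
proof -
  let ?L = "lebesgue_on_coords {1..<n}"
  let ?P = "\<lambda>x. base_polytope {1..n} {1..m} (nbrs G) y (x(n := sum y {1..m} - sum x {1..<n}))"
  have En: "{1..n} - {n} = {1..<n}" by auto
  have nE: "n \<in> {1..n}" using assms(2) by simp
  have pred: "Measurable.pred ?L ?P"
    using base_polytope_fill_measurable[OF _ _ nE, of "{1..m}" "nbrs G" y "sum y {1..m}"]
    unfolding En by simp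
  then have sets: "{x \<in> space ?L. ?P x} \<in> sets ?L"
    by (rule predE)
  have "emeasure ?L {x \<in> space ?L. ?P x} = (\<integral>\<^sup>+x. indicator {x \<in> space ?L. ?P x} x \<partial>?L)"
    using sets by simp
  also have "\<dots> = base_vol {1..n} n {1..m} (nbrs G) y"
    unfolding base_vol_def En by (intro nn_integral_cong) (auto simp: indicator_def)
  also have "\<dots> = ennreal (drac_sum {1..n} {1..m} (nbrs G) y)"
    using assms nE
    by (intro base_vol_eq_drac_sum)
      (auto simp: bipartite_subgraph_def no_isolated_vertices_def nbrs_def)
  finally have vol: "emeasure ?L {x \<in> space ?L. ?P x} = ennreal (drac_sum {1..n} {1..m} (nbrs G) y)" .
  have "(\<lambda>t. restrict t {1..<n}) ` gen_permutohedron m G y = {x \<in> space ?L. ?P x}"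
    by (intro proj_gen_permutohedron assms)
  then have "proj_vol n (gen_permutohedron m G y) = drac_sum {1..n} {1..m} (nbrs G) y"
    using vol drac_sum_nonneg[of "{1..m}" y "{1..n}" "nbrs G"] assms(5)
    by (simp only: proj_vol_def measure_def enn2real_ennreal)
  also have "\<dots> = (\<Sum>a | draconian m n G a. \<Prod>i\<in>{1..m}. y i ^ a i / fact (a i))"
    unfolding drac_sum_def monom_val_def draconian_iff[OF assms(3,4,2)] by simp
  finally show ?thesis .
qed

end
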